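(* Let $G$ be the fundamental solution of the discrete wave equation on $\mathbb{Z}^5$. Then there exists a constant $C>0$ such that for all $x\in\mathbb{Z}^5$ and all $t\in\mathbb{R}$, $$|G(x,t)|\le C(1+|t|)^{-\frac{11}{6}}.$$
   Context: For $d=5$, the fundamental solution of the discrete wave equation $\partial_t^2u-\Delta u=0$ on $\mathbb{Z}^d\times\mathbb{R}$, where $\Delta u(x,t)=\sum_{j=1}^d\big(u(x+\boldsymbol{e_j},t)+u(x-\boldsymbol{e_j},t)-2u(x,t)\big)$ and $\{\boldsymbol{e_j}\}$ is the standard basis, is $$G(x,t)=\frac{1}{(2\pi)^d}\int_{\mathbb{T}^d}e^{ix\cdot\xi}\,\frac{\sin(t\,\omega(\xi))}{\omega(\xi)}\,d\xi,\qquad \omega(\xi)=\Big(\sum_{j=1}^d(2-2\cos\xi_j)\Big)^{1/2},$$ where $\mathbb{T}^d=[-\pi,\pi]^d$ and $x\cdot\xi=\sum_{j=1}^dx_j\xi_j$. *)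

theory Defs
  imports "HOL-Analysis.Analysis"
begin

definition dispersion :: "real ^ 'd::finite \<Rightarrow> real"
  where "dispersion \<xi> = sqrt (\<Sum>j\<in>UNIV. 2 - 2 * cos (\<xi> $ j))"

definition torus :: "(real ^ 'd::finite) set"
  where "torus = {\<xi>. \<forall>j. - pi \<le> \<xi> $ j \<and> \<xi> $ j \<le> pi}"

text \<open>
  Fundamental solution of the discrete wave equation $\partial_t^2 u - \Delta u = 0$ on
  the integer lattice, with
  $\Delta u(x,t) = \sum_j (u(x+e_j,t) + u(x-e_j,t) - 2 u(x,t))$, given by its Fourier
  representation; \<open>- dispersion \<xi> ^ 2\<close> is the symbol of $\Delta$.

  The only zero of \<open>dispersion\<close> in \<open>torus\<close> is the origin. There division by zero gives the
  quotient \<open>sin (t * dispersion \<xi>) / dispersion \<xi>\<close> the value 0 instead of its limit \<open>t\<close>,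
  which does not affect the integral.
\<close>

definition fundamental_solution :: "int ^ 'd::finite \<Rightarrow> real \<Rightarrow> complex"
  where "fundamental_solution x t =
    1 / (2 * of_real pi) ^ CARD('d) *
    (LINT \<xi>:torus|lborel.
       exp (\<i> * of_real (\<Sum>j\<in>UNIV. of_int (x $ j) * \<xi> $ j)) *
       of_real (sin (t * dispersion \<xi>) / dispersion \<xi>))"

end

theory Submission
  imports Defs "HOL-Real_Asymp.Real_Asymp"
begin

text \<open>
  Write \<open>\<omega>\<close> for the dispersion. Glasser's substitution in a Fresnel integral gives, for \<open>t > 0\<close> and up to
  a nonzero constant, \<open>exp (\<i> t \<omega>) / \<omega> = \<integral>\<^sub>0\<^sup>\<infinity> exp (\<i> (t\<^sup>2 / 4 u\<^sup>2 + u\<^sup>2 \<omega>\<^sup>2)) du\<close>. Since \<open>\<omega>\<^sup>2\<close> is a sum over the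
  coordinates, integrating over the torus first turns the second factor into a product \<open>F u\<close> of five
  one-dimensional Schroedinger propagators at time \<open>u\<^sup>2\<close>, that is, of Bessel functions. Van der Corput's
  method bounds each of them by \<open>u\<close> to the power \<open>-2/3\<close>, with a gain off the light cone strong enough that the
  fifth power has \<open>\<integral>\<^sub>R\<^sup>\<infinity> \<bar>b\<bar>\<^sup>5 = O(R powr (- 11/3))\<close> uniformly in the lattice point. A product of five factors is
  at most the sum of their fifth powers, so the same bound holds for \<open>F\<close>, and for \<open>F' / u\<close>. With \<open>T = sqrt t\<close> the range \<open>u \<ge> T\<close>
  contributes \<open>O(T powr (- 11/3))\<close> without using the oscillation, and a single integration by parts against
  \<open>exp (\<i> t\<^sup>2 / 4 u\<^sup>2)\<close> gives the same for \<open>u \<le> T\<close>.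
\<close>

section \<open>Oscillatory integrals\<close>

text \<open>The square root in \<omega> couples the coordinates and is singular at the origin, and
  the bound must be uniform in \<open>x\<close>, also where critical points of the phase degenerate.
  The Fresnel integral trades \<omega> for its square, so all degeneracy is one-dimensional. There
  the worst size, \<open>u\<close> to the power -2/3, occurs only in a window of width about
  \<open>u\<close> to the power -1/3 around the light cone
  \<open>\<bar>m\<bar> = 2 * u\<^sup>2\<close>; the fifth power contributes -10/3 - 1/3 = -11/3, and
  \<open>T = sqrt t\<close> halves this exponent. The scale \<open>sqrt t\<close> is that of the
  stationary point \<open>sqrt (t / (2 * w))\<close> of the Fresnel phase at a value
  \<open>w\<close> of \<omega> of order one. The integral over \<open>u\<close> converges only
  conditionally, its integrand having modulus one, so the order of integration is exchanged between
  cutoffs \<open>1 / n\<close> and \<open>n\<close>. The cutoffs are then removed by dominated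
  convergence, with a majorant that grows like the inverse square of \<omega> at the origin and is
  integrable because 2 < 5. Of the Fresnel constant only its being nonzero matters: it is divided
  out at the end.\<close>

lemma norm_integral_by_parts:
  fixes h P R :: "real \<Rightarrow> complex" and D D' :: "real \<Rightarrow> real"
  assumes ab: "a \<le> b" and h: "continuous_on {a..b} h"
    and P: "\<And>x. x \<in> {a..b} \<Longrightarrow> (P has_vector_derivative h x + R x) (at x within {a..b})"
    and D: "\<And>x. x \<in> {a..b} \<Longrightarrow> (D has_vector_derivative D' x) (at x within {a..b})"
    and R: "\<And>x. x \<in> {a..b} \<Longrightarrow> norm (R x) \<le> D' x"
  shows "norm (integral {a..b} h) \<le> norm (P a) + norm (P b) + (D b - D a)"
proof (cases "a = b")
  case True
  then show ?thesis by simp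
next
  case False
  define H where "H x = integral {a..x} h" for x
  \<comment> \<open>\<open>P\<close> is only an approximate antiderivative of \<open>h\<close>. The
    defect \<open>Q\<close> has derivative \<open>R\<close>, and \<open>D\<close> controls its
    variation; comparing derivatives avoids any integrability of \<open>R\<close>.\<close>
  define Q where "Q x = P x - H x" for x
  have Hd: "(H has_vector_derivative h x) (at x within {a..b})" if "x \<in> {a..b}" for x
    unfolding H_def using integral_has_vector_derivative[OF h that] .
  have Qd: "(Q has_vector_derivative R x) (at x within {a..b})" if "x \<in> {a..b}" for x
    unfolding Q_def using has_vector_derivative_diff[OF P[OF that] Hd[OF that]] by simp
  have "norm (Q b - Q a) \<le> D b - D a"
  proof (rule differentiable_bound_general)
    show "a < b" using ab False by simp
    show "continuous_on {a..b} Q" "continuous_on {a..b} D"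
      using Qd D by (force intro: has_vector_derivative_continuous simp: continuous_on_eq_continuous_within)+
    fix x assume x: "a < x" "x < b"
    show "(Q has_vector_derivative R x) (at x)" "(D has_vector_derivative D' x) (at x)"
      using Qd[of x] D[of x] x by (simp_all add: has_vector_derivative_within_open[of _ "{a<..<b}"]
          at_within_Icc_at)
    show "norm (R x) \<le> D' x" using R x by simp
  qed
  moreover have "integral {a..b} h = P b - P a - (Q b - Q a)"
    by (simp add: Q_def H_def)
  ultimately show ?thesis
    by (smt (verit) norm_triangle_ineq4)
qed

lemma has_vector_derivative_cis:
  assumes "(\<phi> has_real_derivative g) (at x within S)"
  shows "((\<lambda>x. cis (\<phi> x)) has_vector_derivative \<i> * of_real g * cis (\<phi> x)) (at x within S)"
  using has_derivative_cis[OF assms[unfolded has_real_derivative_iff_has_vector_derivative has_vector_derivative_def]]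
  by (simp add: has_vector_derivative_def scaleR_conv_of_real mult_ac)

text \<open>Integration by parts with \<open>- \<i> * cis (\<phi> x) / g x\<close>. Since
  \<open>g\<close> is increasing, the error has norm \<open>g' / g\<^sup>2\<close>, the derivative
  of \<open>- 1 / g\<close>, so its total is read off at the endpoints. Four endpoint values of size
  \<open>1 / \<mu>\<close> give the constant 4.\<close>

lemma van_der_Corput_first_derivative:
  fixes \<phi> g g' :: "real \<Rightarrow> real"
  assumes cd: "c \<le> d" and \<mu>: "\<mu> > 0"
    and \<phi>: "\<And>x. (\<phi> has_real_derivative g x) (at x)"
    and g: "\<And>x. (g has_real_derivative g' x) (at x)"
    and pos: "\<And>x. x \<in> {c..d} \<Longrightarrow> g' x \<ge> 0"
    and big: "(\<forall>x\<in>{c..d}. g x \<ge> \<mu>) \<or> (\<forall>x\<in>{c..d}. g x \<le> - \<mu>)"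
  shows "norm (integral {c..d} (\<lambda>x. cis (\<phi> x))) \<le> 4 / \<mu>"
proof -
  have nz: "g x \<noteq> 0" and ge: "\<bar>g x\<bar> \<ge> \<mu>" if "x \<in> {c..d}" for x
    using big that \<mu> by fastforce+
  have inv: "\<bar>1 / g x\<bar> \<le> 1 / \<mu>" if "x \<in> {c..d}" for x
    using ge[OF that] \<mu> by (simp add: divide_simps abs_if split: if_splits)
  have "norm (integral {c..d} (\<lambda>x. cis (\<phi> x)))
      \<le> norm (-\<i> * (cis (\<phi> c) * of_real (1 / g c))) + norm (-\<i> * (cis (\<phi> d) * of_real (1 / g d))) + (- 1 / g d - (- 1 / g c))"
  proof (rule norm_integral_by_parts[OF cd])
    have "continuous_on {c..d} \<phi>"
      using \<phi> by (meson DERIV_isCont continuous_at_imp_continuous_on)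
    then show "continuous_on {c..d} (\<lambda>x. cis (\<phi> x))"
      by (intro continuous_intros)
    fix x assume x: "x \<in> {c..d}"
    have [derivative_intros]: "((\<lambda>x. of_real (1 / g x)) has_vector_derivative complex_of_real (- g' x / (g x)\<^sup>2)) (at x within {c..d})"
      by (intro has_vector_derivative_of_real)
        (use nz[OF x] in \<open>auto intro!: derivative_eq_intros g[THEN DERIV_subset] simp: power2_eq_square\<close>)
    have "((\<lambda>x. -\<i> * (cis (\<phi> x) * of_real (1 / g x))) has_vector_derivative
       -\<i> * (cis (\<phi> x) * complex_of_real (- g' x / (g x)\<^sup>2) + \<i> * of_real (g x) * cis (\<phi> x) * of_real (1 / g x))) (at x within {c..d})"
      by (intro has_vector_derivative_mult_right has_vector_derivative_mult has_vector_derivative_cis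
          derivative_intros \<phi>[THEN DERIV_subset] subset_UNIV)
    then show "((\<lambda>x. -\<i> * (cis (\<phi> x) * of_real (1 / g x))) has_vector_derivative cis (\<phi> x) + (\<i> * cis (\<phi> x) * complex_of_real (g' x / (g x)\<^sup>2))) (at x within {c..d})"
      using nz[OF x] by (simp add: divide_simps algebra_simps)
    show "((\<lambda>x. - 1 / g x) has_vector_derivative (g' x / (g x)\<^sup>2)) (at x within {c..d})"
      unfolding has_real_derivative_iff_has_vector_derivative[symmetric]
      using nz[OF x] by (auto intro!: derivative_eq_intros g[THEN DERIV_subset] simp: power2_eq_square)
    show "norm (\<i> * cis (\<phi> x) * complex_of_real (g' x / (g x)\<^sup>2)) \<le> g' x / (g x)\<^sup>2"
      using pos[OF x] by (simp add: norm_mult norm_divide norm_power)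
  qed
  also have "\<dots> \<le> 1 / \<mu> + 1 / \<mu> + (1 / \<mu> + 1 / \<mu>)"
  proof -
    have *: "norm (-\<i> * (cis (\<phi> x) * of_real (1 / g x))) = \<bar>1 / g x\<bar>" for x
      by (simp add: norm_mult norm_divide)
    have "\<bar>1 / g c\<bar> \<le> 1 / \<mu>" "\<bar>1 / g d\<bar> \<le> 1 / \<mu>"
      using inv cd by auto
    then show ?thesis unfolding * by linarith
  qed
  finally show ?thesis by simp
qed

text \<open>The guards \<open>c < p\<close> and \<open>p < d\<close> are there because a one-point
  piece may lie on the wrong side of the threshold: if \<open>g c > \<tau>\<close>, then
  \<open>p = c\<close>. Such pieces have integral zero.\<close>

lemma monotone_threshold:
  fixes g :: "real \<Rightarrow> real"
  assumes "c \<le> d" "continuous_on {c..d} g" "mono_on {c..d} g"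
  obtains p where "c \<le> p" "p \<le> d" "c < p \<Longrightarrow> \<forall>x\<in>{c..p}. g x \<le> \<tau>" "p < d \<Longrightarrow> \<forall>x\<in>{p..d}. \<tau> \<le> g x"
proof (cases "g c \<ge> \<tau>")
  case True
  have "\<tau> \<le> g x" if "x \<in> {c..d}" for x
    using True mono_onD[OF assms(3), of c x] that by auto
  then show ?thesis using that[of c] assms by auto
next
  case False
  show ?thesis
  proof (cases "g d \<le> \<tau>")
    case True
    have "g x \<le> \<tau>" if "x \<in> {c..d}" for x
      using True mono_onD[OF assms(3), of x d] that by auto
    then show ?thesis using that[of d] assms by auto
  next
    case F: False
    obtain p where p: "c \<le> p" "p \<le> d" "g p = \<tau>"
      using IVT'[of g c \<tau> d] False F assms by auto
    have "g x \<le> \<tau>" if "x \<in> {c..p}" for x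
      using mono_onD[OF assms(3), of x p] that p by auto
    moreover have "\<tau> \<le> g x" if "x \<in> {p..d}" for x
      using mono_onD[OF assms(3), of p x] that p by auto
    ultimately show ?thesis using that[of p] p by auto
  qed
qed

text \<open>Cut where \<open>g\<close> crosses \<open>- \<mu>\<close> and \<open>\<mu>\<close>. The
  outer pieces cost \<open>4 / \<mu>\<close> each, the middle one at most its length. That length
  stays a parameter \<open>w\<close> because the sine admits two useful width bounds, one valid up
  to its turning points and one better away from them.\<close>

lemma van_der_Corput_sublevel:
  fixes \<phi> g g' :: "real \<Rightarrow> real"
  assumes cd: "c \<le> d" and \<mu>: "\<mu> > 0"
    and \<phi>: "\<And>x. (\<phi> has_real_derivative g x) (at x)"
    and g: "\<And>x. (g has_real_derivative g' x) (at x)"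
    and pos: "\<And>x. x \<in> {c..d} \<Longrightarrow> g' x \<ge> 0"
    and w0: "w \<ge> 0"
    and w: "\<And>x y. c \<le> x \<Longrightarrow> x \<le> y \<Longrightarrow> y \<le> d \<Longrightarrow> \<bar>g x\<bar> \<le> \<mu> \<Longrightarrow> \<bar>g y\<bar> \<le> \<mu> \<Longrightarrow> y - x \<le> w"
  shows "norm (integral {c..d} (\<lambda>x. cis (\<phi> x))) \<le> w + 8 / \<mu>"
proof -
  have cont: "continuous_on S g" for S
    using g by (meson DERIV_isCont continuous_at_imp_continuous_on)
  have mono: "mono_on {c..d} g"
  proof (rule mono_onI)
    fix x y assume xy: "x \<in> {c..d}" "y \<in> {c..d}" "x \<le> y"
    show "g x \<le> g y"
      by (rule DERIV_nonneg_imp_nondecreasing[OF xy(3)]) (use g pos xy in \<open>auto intro!: exI\<close>)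
  qed
  obtain p where p: "c \<le> p" "p \<le> d" "c < p \<Longrightarrow> \<forall>x\<in>{c..p}. g x \<le> - \<mu>" "p < d \<Longrightarrow> \<forall>x\<in>{p..d}. - \<mu> \<le> g x"
    using monotone_threshold[OF cd cont mono, where \<tau> = "- \<mu>"] by metis
  have "mono_on {p..d} g" using mono p(1) by (auto intro: monotone_on_subset)
  then obtain q where q: "p \<le> q" "q \<le> d" "p < q \<Longrightarrow> \<forall>x\<in>{p..q}. g x \<le> \<mu>" "q < d \<Longrightarrow> \<forall>x\<in>{q..d}. \<mu> \<le> g x"
    using monotone_threshold[OF p(2) cont, where \<tau> = \<mu>] by metis
  let ?I = "\<lambda>a b. integral {a..b} (\<lambda>x. cis (\<phi> x))"
  have "continuous_on UNIV \<phi>"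
    using \<phi> by (meson DERIV_isCont continuous_at_imp_continuous_on)
  then have cis: "continuous_on {a..b} (\<lambda>x. cis (\<phi> x))" for a b
    by (intro continuous_intros) (auto intro: continuous_on_subset)
  have int: "(\<lambda>x. cis (\<phi> x)) integrable_on {a..b}" for a b
    by (rule integrable_continuous_real[OF cis])
  have I1: "norm (?I c p) \<le> 4 / \<mu>"
  proof (cases "c < p")
    case True
    show ?thesis
      by (rule van_der_Corput_first_derivative[OF p(1) \<mu> \<phi> g]) (use pos p True in auto)
  qed (use p \<mu> in auto)
  have I3: "norm (?I q d) \<le> 4 / \<mu>"
  proof (cases "q < d")
    case True
    show ?thesis
      by (rule van_der_Corput_first_derivative[OF q(2) \<mu> \<phi> g]) (use pos p q True in auto)
  qed (use q \<mu> in auto)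
  have "q - p \<le> w"
  proof (cases "p < q")
    case True
    then have "- \<mu> \<le> g p" "g p \<le> \<mu>" "- \<mu> \<le> g q" "g q \<le> \<mu>"
      using p(4) q by auto
    then show ?thesis using p q by (intro w) (auto simp: abs_le_iff)
  qed (use w0 in auto)
  moreover have "norm (?I p q) \<le> 1 * (q - p)"
    by (rule integral_bound) (use q cis in auto)
  moreover have "?I c d = ?I c p + ?I p q + ?I q d"
    using p q int by (simp add: Henstock_Kurzweil_Integration.integral_combine)
  ultimately show ?thesis using I1 I3
    by (smt (verit) norm_triangle_ineq add_divide_distrib)
qed

section \<open>Widths of sublevel sets of a shifted sine\<close>

lemma Jordan_sin_ge:
  assumes "0 \<le> x" "x \<le> pi / 2"
  shows "2 / pi * x \<le> sin x"
proof -
  have "concave_on {0..pi/2} sin"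
  proof (rule f''_le0_imp_concave)
    fix x :: real assume "x \<in> {0..pi/2}"
    then show "- sin x \<le> 0" by (auto intro!: sin_ge_zero)
  qed (auto intro!: derivative_eq_intros)
  from concave_onD[OF this, of "2 / pi * x" 0 "pi / 2"] assms
  show ?thesis by (simp add: field_simps)
qed

text \<open>The worst case is a set at a turning point, where the sine is quadratic. For half width
  \<open>h\<close> and midpoint \<open>m\<close>, \<open>\<bar>m\<bar> \<le> pi / 2 - h\<close>
  forces \<open>cos m \<ge> sin h\<close>, so the increment \<open>2 * sin h * cos m\<close> is at
  least \<open>2 * (sin h)\<^sup>2\<close>. Jordan's inequality turns
  \<open>sin h \<le> sqrt \<epsilon>\<close> into a length.\<close>

lemma sin_sublevel_width_sqrt:
  assumes "- (pi / 2) \<le> x" "x \<le> y" "y \<le> pi / 2" "\<bar>a + sin x\<bar> \<le> \<epsilon>" "\<bar>a + sin y\<bar> \<le> \<epsilon>"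
  shows "y - x \<le> pi * sqrt \<epsilon>"
proof -
  define h m where "h = (y - x) / 2" and "m = (x + y) / 2"
  have h: "0 \<le> h" "h \<le> pi / 2" using assms by (auto simp: h_def)
  have eps: "\<epsilon> \<ge> 0" using assms(4) by linarith
  have "sin y - sin x = 2 * sin h * cos m"
    using sin_diff_sin[of y x] by (simp add: h_def m_def add.commute)
  moreover have "sin y - sin x \<le> 2 * \<epsilon>" using assms(4,5) by linarith
  moreover have "cos m \<ge> sin h"
  proof -
    have "\<bar>m\<bar> \<le> pi / 2 - h" using assms by (auto simp: h_def m_def abs_le_iff field_simps)
    then have "cos (pi / 2 - h) \<le> cos \<bar>m\<bar>"
      using h by (intro cos_monotone_0_pi_le) auto
    then show ?thesis by (simp add: cos_diff)
  qed
  moreover have sh: "sin h \<ge> 0" using h by (intro sin_ge_zero) auto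
  ultimately have "sin h * sin h \<le> \<epsilon>"
    using mult_left_mono[of "sin h" "cos m" "sin h"] by linarith
  then have "sin h \<le> sqrt \<epsilon>"
    using sh by (intro real_le_rsqrt) (simp add: power2_eq_square)
  moreover have "2 / pi * h \<le> sin h"
    by (rule Jordan_sin_ge[OF h])
  ultimately have "2 / pi * h \<le> sqrt \<epsilon>" by linarith
  then show ?thesis by (simp add: h_def field_simps)
qed

text \<open>\<open>\<delta>\<close> is the distance from tangency \<open>\<bar>a\<bar> = 1\<close>,
  which will be the light cone. For \<open>\<epsilon> < \<delta> / 2\<close> the set stays where the
  sine has slope at least \<open>sqrt (\<delta> / 2)\<close>; otherwise the square-root bound
  already has the claimed size. The constant 5 covers \<open>pi * sqrt 2\<close> from the latter
  case and 4 from the former.\<close>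

lemma sin_sublevel_width_transversal:
  assumes "- (pi / 2) \<le> x" "x \<le> y" "y \<le> pi / 2" "\<bar>a + sin x\<bar> \<le> \<epsilon>" "\<bar>a + sin y\<bar> \<le> \<epsilon>"
    and \<delta>: "\<delta> = \<bar>1 - \<bar>a\<bar>\<bar>" "\<delta> > 0"
  shows "y - x \<le> 5 * \<epsilon> / sqrt \<delta>"
proof (cases "\<epsilon> \<ge> \<delta> / 2")
  case True
  have eps: "\<epsilon> > 0" using True \<delta> by linarith
  have "sqrt \<epsilon> * sqrt \<delta> \<le> sqrt \<epsilon> * sqrt (2 * \<epsilon>)"
    using True eps by (intro mult_left_mono real_sqrt_le_mono) auto
  also have "\<dots> = sqrt 2 * \<epsilon>" using eps by (simp add: real_sqrt_mult)
  finally have "pi * sqrt \<epsilon> * sqrt \<delta> \<le> pi * (sqrt 2 * \<epsilon>)" by simp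
  also have "\<dots> \<le> 3.2 * (1.5 * \<epsilon>)"
  proof (intro mult_mono)
    show "sqrt 2 \<le> 1.5" by (rule real_le_lsqrt) (auto simp: power2_eq_square)
    show "pi \<le> 3.2" using pi_approx by simp
  qed (use eps in auto)
  also have "\<dots> \<le> 5 * \<epsilon>" using eps by simp
  finally have "pi * sqrt \<epsilon> \<le> 5 * \<epsilon> / sqrt \<delta>" using \<delta>(2) by (simp add: field_simps)
  then show ?thesis using sin_sublevel_width_sqrt[OF assms(1-5)] by linarith
next
  case False
  have eps: "\<epsilon> \<ge> 0" using assms(4) by linarith
  show ?thesis
  proof (cases "x = y")
    case True
    then show ?thesis using eps \<delta>(2) by simp
  next
    case F: False
    \<comment> \<open>If \<open>\<bar>a\<bar> > 1\<close> there is no such \<open>z\<close>; if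
      \<open>\<bar>a\<bar> < 1\<close>, then \<open>\<bar>sin z\<bar> \<le> \<bar>a\<bar> +
      \<epsilon> = 1 - \<delta> + \<epsilon>\<close>.\<close>
    have sinb: "\<bar>sin z\<bar> \<le> 1 - \<delta> / 2" if "\<bar>a + sin z\<bar> \<le> \<epsilon>" for z
      using that False \<delta> abs_sin_le_one[of z] by linarith
    obtain z where z: "x < z" "z < y" "sin y - sin x = (y - x) * cos z"
      using MVT2[of x y sin cos] assms(2) F by (auto intro: DERIV_sin)
    have "sin x \<le> sin z" "sin z \<le> sin y"
      using z(1,2) assms(1,3) by (auto intro!: sin_monotone_2pi_le)
    then have sz: "\<bar>sin z\<bar> \<le> 1 - \<delta> / 2" using sinb[of x] sinb[of y] assms by linarith
    have "(sin z)\<^sup>2 \<le> (1 - \<delta> / 2)\<^sup>2" using power_mono[OF sz, of 2] by simp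
    also have "\<dots> = (1 - \<delta> / 2) * (1 - \<delta> / 2)" by (simp add: power2_eq_square)
    also have "\<dots> \<le> (1 - \<delta> / 2) * 1"
      using sz \<delta>(2) by (intro mult_left_mono) linarith+
    finally have "\<delta> / 2 \<le> (cos z)\<^sup>2" by (simp add: cos_squared_eq)
    then have "sqrt (\<delta> / 2) \<le> cos z"
      using cos_ge_zero[of z] z(1,2) assms(1,3) by (intro real_le_lsqrt) linarith+
    moreover have "sqrt \<delta> / 2 \<le> sqrt (\<delta> / 2)"
      using \<delta>(2) by (intro real_le_rsqrt) (simp add: power_divide)
    ultimately have "(y - x) * (sqrt \<delta> / 2) \<le> (y - x) * cos z"
      using assms(2) by (intro mult_left_mono) linarith+
    also have "\<dots> \<le> 2 * \<epsilon>" using z assms by linarith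
    finally have "(y - x) * sqrt \<delta> \<le> 4 * \<epsilon>" by simp
    then have "y - x \<le> 4 * \<epsilon> / sqrt \<delta>" using \<delta>(2) by (simp add: field_simps)
    also have "\<dots> \<le> 5 * \<epsilon> / sqrt \<delta>" using eps \<delta>(2) by (intro divide_right_mono) auto
    finally show ?thesis .
  qed
qed

lemma cos_phase_integral_bound:
  assumes "- (pi / 2) \<le> c" "c \<le> d" "d \<le> pi / 2" "r > 0" "\<epsilon> > 0" "w \<ge> 0"
    and w: "\<And>x y. - (pi / 2) \<le> x \<Longrightarrow> x \<le> y \<Longrightarrow> y \<le> pi / 2 \<Longrightarrow>
              \<bar>m / r + sin x\<bar> \<le> \<epsilon> \<Longrightarrow> \<bar>m / r + sin y\<bar> \<le> \<epsilon> \<Longrightarrow> y - x \<le> w"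
  shows "norm (integral {c..d} (\<lambda>\<xi>. cis (m * \<xi> - r * cos \<xi>))) \<le> w + 8 / (r * \<epsilon>)"
proof (rule van_der_Corput_sublevel[where g = "\<lambda>\<xi>. m + r * sin \<xi>" and g' = "\<lambda>\<xi>. r * cos \<xi>"])
  show "((\<lambda>\<xi>. m * \<xi> - r * cos \<xi>) has_real_derivative m + r * sin x) (at x)" for x
    by (rule derivative_eq_intros refl | simp)+
  show "((\<lambda>\<xi>. m + r * sin \<xi>) has_real_derivative r * cos x) (at x)" for x
    by (rule derivative_eq_intros refl | simp)+
  show "r * \<epsilon> > 0" using assms(4,5) by simp
  fix x assume "x \<in> {c..d}"
  then show "0 \<le> r * cos x" using assms(1-4) by (intro mult_nonneg_nonneg cos_ge_zero) auto
next
  have *: "\<bar>m + r * sin x\<bar> \<le> r * \<epsilon> \<longleftrightarrow> \<bar>m / r + sin x\<bar> \<le> \<epsilon>" for x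
  proof -
    have "\<bar>m + r * sin x\<bar> = \<bar>r * (m / r + sin x)\<bar>" using \<open>r > 0\<close> by (simp add: distrib_left)
    also have "\<dots> = r * \<bar>m / r + sin x\<bar>" using \<open>r > 0\<close> by (simp add: abs_mult)
    finally have "\<bar>m + r * sin x\<bar> = r * \<bar>m / r + sin x\<bar>" .
    then show ?thesis using mult_le_cancel_left_pos[OF \<open>r > 0\<close>] by presburger
  qed
  fix x y assume "c \<le> x" "x \<le> y" "y \<le> d" "\<bar>m + r * sin x\<bar> \<le> r * \<epsilon>" "\<bar>m + r * sin y\<bar> \<le> r * \<epsilon>"
  then show "y - x \<le> w" unfolding * using assms(1-6) by (intro w) auto
qed (use assms(2,6) in auto)

text \<open>Where the cosine is negative, the phase derivative decreases. The reflection of \<xi> to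
  \<open>p - \<xi>\<close> flips the sign of the cosine, so the phase becomes its own negative up to
  a constant. Conjugation preserves the norm, which brings these pieces back to
  \<open>{- (pi / 2)..pi / 2}\<close>.\<close>

lemma reflected_cos_phase_integral:
  assumes "c \<le> d" and p: "p = pi \<or> p = - pi"
  shows "norm (integral {c..d} (\<lambda>\<xi>. cis (m * \<xi> - r * cos \<xi>)))
    = norm (integral {p - d..p - c} (\<lambda>\<xi>. cis (m * \<xi> - r * cos \<xi>)))"
proof -
  have "cis (m * \<xi> - r * cos \<xi>) = cis (m * p) * cnj (cis (m * (p - \<xi>) - r * cos (p - \<xi>)))" for \<xi>
    proof -
    have "cos (p - \<xi>) = - cos \<xi>" using p by (auto simp: cos_diff)
    then show ?thesis unfolding cis_cnj cis_mult by (simp add: right_diff_distrib)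
  qed
  then have "integral {c..d} (\<lambda>\<xi>. cis (m * \<xi> - r * cos \<xi>)) =
     integral {c..d} (\<lambda>\<xi>. cis (m * p) * cnj (cis (m * (p - \<xi>) - r * cos (p - \<xi>))))"
    by (rule integral_cong)
  also have "\<dots> = cis (m * p) * integral {c..d} (\<lambda>\<xi>. cnj (cis (m * (p - \<xi>) - r * cos (p - \<xi>))))"
    by (rule integral_mult_right)
  also have "integral {c..d} (\<lambda>\<xi>. cnj (cis (m * (p - \<xi>) - r * cos (p - \<xi>)))) =
     cnj (integral {c..d} (\<lambda>\<xi>. cis (m * (p - \<xi>) - r * cos (p - \<xi>))))"
    by (rule integral_cnj[symmetric])
  also have "integral {c..d} (\<lambda>\<xi>. cis (m * (p - \<xi>) - r * cos (p - \<xi>)))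
     = integral {p - d..p - c} (\<lambda>\<xi>. cis (m * \<xi> - r * cos \<xi>))"
  proof -
    define f where "f \<xi> = cis (m * \<xi> - r * cos \<xi>)" for \<xi>
    have "f integrable_on {p - d..p - c}"
      unfolding f_def by (intro integrable_continuous_real continuous_intros)
    then have "(f has_integral integral {p - d..p - c} f) (cbox (p - d) (p - c))"
      by (simp add: integrable_integral)
    then have "((\<lambda>\<xi>. f (p - \<xi>)) has_integral integral {p - d..p - c} f) ((\<lambda>x. p - x) ` {p - d..p - c})"
      using has_integral_affinity[of f _ "p - d" "p - c" "-1" p] by simp
    moreover have "(\<lambda>x. p - x) ` {p - d..p - c} = {c..d}"
      by simp
    ultimately have "((\<lambda>\<xi>. f (p - \<xi>)) has_integral integral {p - d..p - c} f) {c..d}"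
      by simp
    then show ?thesis unfolding f_def by (rule integral_unique)
  qed
  finally show ?thesis
    by (simp only: norm_mult norm_cis complex_mod_cnj mult_1)
qed

section \<open>The one-dimensional propagator\<close>

lemma power_mult_powr: "x > 0 \<Longrightarrow> x ^ n * x powr a = x powr (real n + a)" for x :: real
  by (simp add: powr_add powr_realpow)

lemma power_powr: "x > 0 \<Longrightarrow> (x ^ n) powr a = x powr (real n * a)" for x :: real
  by (metis powr_powr powr_realpow)

text \<open>For integer \<open>m\<close> this is
  \<open>2 * pi * (- \<i>) ^ \<bar>m\<bar> * cis (2 * u\<^sup>2)\<close> times the Bessel function
  of order \<open>\<bar>m\<bar>\<close> at \<open>2 * u\<^sup>2\<close>. The variable is the square
  root of time, as the Fresnel integral delivers it.\<close>

definition lattice_propagator :: "real \<Rightarrow> real \<Rightarrow> complex"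
  where "lattice_propagator m u = integral {-pi..pi} (\<lambda>\<xi>. cis (m * \<xi> + u\<^sup>2 * (2 - 2 * cos \<xi>)))"

lemma norm_lattice_propagator_le: "norm (lattice_propagator m u) \<le> 2 * pi"
proof -
  have "norm (lattice_propagator m u) \<le> 1 * (pi - (-pi))"
    unfolding lattice_propagator_def
    by (rule integral_bound) (auto intro!: continuous_intros)
  then show ?thesis by simp
qed

lemma continuous_on_lattice_propagator: "continuous_on S (lattice_propagator m)"
proof -
  have "continuous_on UNIV (\<lambda>u. integral (cbox (-pi) pi) (\<lambda>\<xi>. cis (m * \<xi> + u\<^sup>2 * (2 - 2 * cos \<xi>))))"
    by (rule integral_continuous_on_param) (auto intro!: continuous_intros simp: split_beta)
  then show ?thesis
    unfolding lattice_propagator_def[abs_def] by (auto intro: continuous_on_subset)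
qed

text \<open>The factor 3 counts the central half of the period, where the phase derivative
  increases, and the two outer quarters, each reflected into it.\<close>

lemma norm_lattice_propagator_sublevel:
  assumes u: "u > 0" and "\<epsilon> > 0" "w \<ge> 0"
    and w: "\<And>x y. - (pi / 2) \<le> x \<Longrightarrow> x \<le> y \<Longrightarrow> y \<le> pi / 2 \<Longrightarrow>
              \<bar>m / (2 * u\<^sup>2) + sin x\<bar> \<le> \<epsilon> \<Longrightarrow> \<bar>m / (2 * u\<^sup>2) + sin y\<bar> \<le> \<epsilon> \<Longrightarrow> y - x \<le> w"
  shows "norm (lattice_propagator m u) \<le> 3 * (w + 8 / (2 * u\<^sup>2 * \<epsilon>))"
proof -
  define f where "f \<xi> = cis (m * \<xi> - 2 * u\<^sup>2 * cos \<xi>)" for \<xi>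
  have r: "2 * u\<^sup>2 > 0" using u by simp
  have int: "f integrable_on {a..b}" for a b
    unfolding f_def by (intro integrable_continuous_real continuous_intros)
  have mid: "norm (integral {c..d} f) \<le> w + 8 / (2 * u\<^sup>2 * \<epsilon>)"
    if "- (pi / 2) \<le> c" "c \<le> d" "d \<le> pi / 2" for c d
    unfolding f_def by (rule cos_phase_integral_bound[OF that r assms(2,3) w])
  have left: "norm (integral {-pi..-(pi/2)} f) \<le> w + 8 / (2 * u\<^sup>2 * \<epsilon>)"
  proof -
    have "norm (integral {-pi..-(pi/2)} f) = norm (integral {- pi - (-(pi/2))..-pi - (-pi)} f)"
      unfolding f_def by (rule reflected_cos_phase_integral) auto
    also have "\<dots> \<le> w + 8 / (2 * u\<^sup>2 * \<epsilon>)"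
      by (rule mid) auto
    finally show ?thesis .
  qed
  have right: "norm (integral {pi/2..pi} f) \<le> w + 8 / (2 * u\<^sup>2 * \<epsilon>)"
  proof -
    have "norm (integral {pi/2..pi} f) = norm (integral {pi - pi..pi - pi/2} f)"
      unfolding f_def by (rule reflected_cos_phase_integral) auto
    also have "\<dots> \<le> w + 8 / (2 * u\<^sup>2 * \<epsilon>)"
      by (rule mid) auto
    finally show ?thesis .
  qed
  have "lattice_propagator m u = integral {-pi..pi} (\<lambda>\<xi>. cis (2 * u\<^sup>2) * f \<xi>)"
    unfolding lattice_propagator_def f_def cis_mult
    by (intro integral_cong arg_cong[of _ _ cis]) (simp add: algebra_simps)
  also have "\<dots> = cis (2 * u\<^sup>2) * integral {-pi..pi} f" by (rule integral_mult_right)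
  finally have "norm (lattice_propagator m u) = norm (integral {-pi..pi} f)"
    by (simp only: norm_mult norm_cis mult_1)
  also have "integral {-pi..pi} f
      = integral {-pi..-(pi/2)} f + integral {-(pi/2)..pi/2} f + integral {pi/2..pi} f"
    using int by (simp add: Henstock_Kurzweil_Integration.integral_combine)
  also have "norm \<dots> \<le> (w + 8 / (2 * u\<^sup>2 * \<epsilon>)) + (w + 8 / (2 * u\<^sup>2 * \<epsilon>)) + (w + 8 / (2 * u\<^sup>2 * \<epsilon>))"
    by (intro norm_triangle_mono left right mid) auto
  finally show ?thesis by simp
qed

lemma lattice_propagator_decay:
  assumes u: "u > 0"
  shows "norm (lattice_propagator m u) \<le> 24 * u powr (- (2/3))"
proof -
  \<comment> \<open>This choice balances the width \<open>sqrt \<epsilon>\<close> against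
    \<open>1 / (u\<^sup>2 * \<epsilon>)\<close>.\<close>
  define \<epsilon> where "\<epsilon> = u powr (- (4/3))"
  have s: "sqrt \<epsilon> = u powr (- (2/3))"
    by (rule real_sqrt_unique) (use u in \<open>simp_all add: \<epsilon>_def powr_power\<close>)
  have e: "u\<^sup>2 * \<epsilon> = u powr (2/3)"
    using power_mult_powr[OF u, of 2 "- (4/3)"] by (simp add: \<epsilon>_def)
  have "norm (lattice_propagator m u) \<le> 3 * (pi * sqrt \<epsilon> + 8 / (2 * u\<^sup>2 * \<epsilon>))"
    by (rule norm_lattice_propagator_sublevel[OF u])
      (use u in \<open>auto simp: \<epsilon>_def intro: sin_sublevel_width_sqrt\<close>)
  also have "8 / (2 * u\<^sup>2 * \<epsilon>) = 4 * u powr (- (2/3))"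
    using e by (simp add: powr_minus field_simps mult.assoc)
  also have "3 * (pi * sqrt \<epsilon> + 4 * u powr (- (2/3))) \<le> 3 * (4 * u powr (- (2/3)) + 4 * u powr (- (2/3)))"
    unfolding s using pi_less_4 by (intro mult_left_mono add_right_mono mult_right_mono) auto
  finally show ?thesis by simp
qed

text \<open>Away from the cone the critical points are nondegenerate and the square-root decay
  improves on the cube-root one. The fourth power clears the roots, and the multiplied form stays
  meaningful on the cone itself, where it is trivial. The constant is 39 = 3 * (5 + 8): the width
  constant and the van der Corput constant, for three pieces.\<close>

lemma lattice_propagator_decay_off_cone:
  assumes u: "u > 0"
  shows "u ^ 3 * \<bar>u - sqrt (\<bar>m\<bar> / 2)\<bar> * norm (lattice_propagator m u) ^ 4 \<le> 39 ^ 4"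
proof (cases "u = sqrt (\<bar>m\<bar> / 2)")
  case True
  then show ?thesis by simp
next
  case False
  define \<mu> r \<delta> where "\<mu> = sqrt (\<bar>m\<bar> / 2)" and "r = 2 * u\<^sup>2" and "\<delta> = \<bar>1 - \<bar>m / r\<bar>\<bar>"
  have r: "r > 0" using u by (simp add: r_def)
  have mu: "\<mu> \<ge> 0" "\<bar>m\<bar> = 2 * \<mu>\<^sup>2" by (auto simp: \<mu>_def)
  have "r * \<delta> = \<bar>r - \<bar>m\<bar>\<bar>"
  proof -
    have "r * \<delta> = \<bar>r * (1 - \<bar>m / r\<bar>)\<bar>" using r by (simp add: \<delta>_def abs_mult)
    also have "r * (1 - \<bar>m / r\<bar>) = r - \<bar>m\<bar>" using r by (simp add: right_diff_distrib)
    finally show ?thesis .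
  qed
  also have "r - \<bar>m\<bar> = 2 * ((u - \<mu>) * (u + \<mu>))"
    unfolding mu(2) r_def by (simp add: power2_eq_square algebra_simps)
  also have "\<bar>\<dots>\<bar> = 2 * \<bar>u - \<mu>\<bar> * (u + \<mu>)" using u mu by (simp add: abs_mult)
  finally have rd: "r * \<delta> = 2 * \<bar>u - \<mu>\<bar> * (u + \<mu>)" .
  then have "r * \<delta> > 0" using False u mu(1) unfolding \<mu>_def[symmetric] by simp
  then have d: "\<delta> > 0" using r by (simp add: zero_less_mult_iff)
  \<comment> \<open>Chosen to make the two contributions \<open>\<epsilon> / sqrt \<delta>\<close>
    and \<open>1 / (r * \<epsilon>)\<close> equal.\<close>
  define \<epsilon> where "\<epsilon> = root 4 (\<delta> / r\<^sup>2)"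
  have e: "\<epsilon> > 0" using d r by (simp add: \<epsilon>_def)
  have e4: "\<epsilon> ^ 4 = \<delta> / r\<^sup>2" using d r by (simp add: \<epsilon>_def)
  have es: "\<epsilon> / sqrt \<delta> = 1 / (r * \<epsilon>)"
  proof -
    have "sqrt \<delta> = r * \<epsilon>\<^sup>2"
      by (rule real_sqrt_unique) (use e4 r in \<open>auto simp: power_mult_distrib\<close>)
    then show ?thesis using e r by (simp add: power2_eq_square)
  qed
  have "norm (lattice_propagator m u) \<le> 3 * (5 * \<epsilon> / sqrt \<delta> + 8 / (r * \<epsilon>))"
    unfolding r_def
  proof (rule norm_lattice_propagator_sublevel[OF u e])
    show "0 \<le> 5 * \<epsilon> / sqrt \<delta>" using e d by simp
    fix x y assume *: "- (pi / 2) \<le> x" "x \<le> y" "y \<le> pi / 2"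
      "\<bar>m / (2 * u\<^sup>2) + sin x\<bar> \<le> \<epsilon>" "\<bar>m / (2 * u\<^sup>2) + sin y\<bar> \<le> \<epsilon>"
    show "y - x \<le> 5 * \<epsilon> / sqrt \<delta>"
      by (rule sin_sublevel_width_transversal[OF * _ d]) (simp add: \<delta>_def r_def)
  qed
  also have "\<dots> = 15 * (\<epsilon> / sqrt \<delta>) + 24 * (1 / (r * \<epsilon>))" by simp
  also have "\<dots> = 39 * (1 / (r * \<epsilon>))" unfolding es by simp
  finally have "norm (lattice_propagator m u) ^ 4 \<le> (39 * (1 / (r * \<epsilon>))) ^ 4"
    by (rule power_mono) simp
  also have "\<dots> = 39 ^ 4 / (r ^ 4 * \<epsilon> ^ 4)" by (simp add: power_mult_distrib power_divide)
  also have "r ^ 4 * \<epsilon> ^ 4 = r * (r * \<delta>)" unfolding e4 using r by (simp add: power2_eq_square power4_eq_xxxx)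
  finally have B: "norm (lattice_propagator m u) ^ 4 \<le> 39 ^ 4 / (r * (r * \<delta>))" .
  have "u ^ 3 * \<bar>u - \<mu>\<bar> \<le> r * (r * \<delta>)"
  proof -
    have "u\<^sup>2 * (\<bar>u - \<mu>\<bar> * u) \<le> u\<^sup>2 * (\<bar>u - \<mu>\<bar> * (u + \<mu>))"
      using mu u by (intro mult_left_mono) auto
    also have "\<dots> \<le> 4 * \<dots>" using mu u by simp
    also have "\<dots> = r * (r * \<delta>)" unfolding rd by (simp add: r_def)
    finally show ?thesis by (simp add: power2_eq_square power3_eq_cube mult_ac)
  qed
  then have "u ^ 3 * \<bar>u - \<mu>\<bar> * norm (lattice_propagator m u) ^ 4 \<le> (r * (r * \<delta>)) * (39 ^ 4 / (r * (r * \<delta>)))"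
    by (rule mult_mono[OF _ B]) (use r d in auto)
  also have "\<dots> = 39 ^ 4" using r d by simp
  finally show ?thesis by (simp add: \<mu>_def)
qed

section \<open>The fifth-power tail of a single propagator\<close>

lemma integral_shifted_powr_le:
  fixes \<rho> \<mu> :: real
  assumes "a \<le> b" and \<rho>: "\<rho> > 0"
  shows "integral {a..b} (\<lambda>u. (\<rho> + \<bar>u - \<mu>\<bar>) powr (- (5/4))) \<le> 8 * \<rho> powr (- (1/4))"
proof -
  \<comment> \<open>The primitives of the two branches, spliced at the kink \<open>\<mu>\<close> by
    \<open>max\<close>. Each branch has mass at most \<open>4 * \<rho> powr (- (1/4))\<close>
    wherever \<open>\<mu>\<close> lies; this is what makes the tail bound uniform in the lattice
    point.\<close>
  define \<Phi> where "\<Phi> u = 4 * (\<rho> + max 0 (\<mu> - u)) powr (- (1/4)) - 4 * (\<rho> + max 0 (u - \<mu>)) powr (- (1/4))" for u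
  have "((\<lambda>u. (\<rho> + \<bar>u - \<mu>\<bar>) powr (- (5/4))) has_integral (\<Phi> b - \<Phi> a)) {a..b}"
  proof (rule fundamental_theorem_of_calculus_strong[of "{\<mu>}"])
    fix u assume "u \<in> {a..b} - {\<mu>}"
    then consider "u < \<mu>" | "u > \<mu>" by force
    then show "(\<Phi> has_vector_derivative (\<rho> + \<bar>u - \<mu>\<bar>) powr (- (5/4))) (at u)"
    proof cases
      case 1
      have "((\<lambda>u. 4 * (\<rho> + (\<mu> - u)) powr (- (1/4)) - 4 * \<rho> powr (- (1/4))) has_real_derivative (\<rho> + \<bar>u - \<mu>\<bar>) powr (- (5/4))) (at u)"
        using 1 \<rho> by (auto intro!: derivative_eq_intros simp: powr_diff[symmetric])
      then have "(\<Phi> has_real_derivative (\<rho> + \<bar>u - \<mu>\<bar>) powr (- (5/4))) (at u)"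
        by (rule has_field_derivative_transform_within_open[where S = "{..<\<mu>}"]) (use 1 in \<open>auto simp: \<Phi>_def\<close>)
      then show ?thesis by (simp add: has_real_derivative_iff_has_vector_derivative)
    next
      case 2
      have "((\<lambda>u. 4 * \<rho> powr (- (1/4)) - 4 * (\<rho> + (u - \<mu>)) powr (- (1/4))) has_real_derivative (\<rho> + \<bar>u - \<mu>\<bar>) powr (- (5/4))) (at u)"
        using 2 \<rho> by (auto intro!: derivative_eq_intros simp: powr_diff[symmetric])
      then have "(\<Phi> has_real_derivative (\<rho> + \<bar>u - \<mu>\<bar>) powr (- (5/4))) (at u)"
        by (rule has_field_derivative_transform_within_open[where S = "{\<mu><..}"]) (use 2 in \<open>auto simp: \<Phi>_def\<close>)
      then show ?thesis by (simp add: has_real_derivative_iff_has_vector_derivative)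
    qed
  next
    show "continuous_on {a..b} \<Phi>"
      unfolding \<Phi>_def using \<rho> by (intro continuous_intros) (auto simp: max_def)
  qed (use assms in auto)
  then have "integral {a..b} (\<lambda>u. (\<rho> + \<bar>u - \<mu>\<bar>) powr (- (5/4))) = \<Phi> b - \<Phi> a"
    by (rule integral_unique)
  also have "\<dots> \<le> 4 * \<rho> powr (- (1/4)) + 4 * \<rho> powr (- (1/4))"
  proof -
    have "(\<rho> + max 0 x) powr (- (1/4)) \<le> \<rho> powr (- (1/4))" for x
      using \<rho> by (intro powr_mono2') auto
    then have "\<Phi> b \<le> 4 * \<rho> powr (- (1/4))" "- \<Phi> a \<le> 4 * \<rho> powr (- (1/4))"
      unfolding \<Phi>_def by (smt (verit) powr_ge_zero)+
    then show ?thesis by linarith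
  qed
  finally show ?thesis by simp
qed

text \<open>The sum of the off-cone constant \<open>39 ^ 4\<close> and the uniform constant
  \<open>24 ^ 4\<close> is at most \<open>2 * 39 ^ 4\<close>; the exponent 5/4 passes from fourth to
  fifth powers, and 8 comes from the integral of the shifted power.\<close>

definition propagator_tail_const :: real
  where "propagator_tail_const = 8 * (2 * 39 ^ 4) powr (5/4)"

lemma propagator_tail_const_pos: "propagator_tail_const > 0"
  by (simp add: propagator_tail_const_def)

text \<open>In \<open>(\<rho> + \<bar>u - \<mu>\<bar>) powr (- (5/4))\<close> the exponent exceeds 1 in modulus: this is what dimension 5 buys.\<close>

lemma lattice_propagator_L5_tail:
  assumes R: "R > 0" "R \<le> q"
  shows "integral {R..q} (\<lambda>u. norm (lattice_propagator m u) ^ 5) \<le> propagator_tail_const * R powr (- (11/3))"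
proof -
  \<comment> \<open>\<open>\<rho>\<close> is the distance to the cone at which the uniform and the
    off-cone bound agree up to constants at \<open>u = R\<close>: both then give a fourth power of
    size \<open>R powr (- (8/3))\<close>.\<close>
  define \<rho> \<mu> K where "\<rho> = R powr (- (1/3))" and "\<mu> = sqrt (\<bar>m\<bar> / 2)" and "K = (2 * 39 ^ 4 :: real)"
  have \<rho>: "\<rho> > 0" using R by (simp add: \<rho>_def)
  have K: "K > 0" by (simp add: K_def)
  have pt: "norm (lattice_propagator m u) ^ 5 \<le> K powr (5/4) * R powr (- (15/4)) * (\<rho> + \<bar>u - \<mu>\<bar>) powr (- (5/4))"
    if u: "u \<in> {R..q}" for u
  proof -
    define B where "B = norm (lattice_propagator m u)"
    have B0: "B \<ge> 0" by (simp add: B_def)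
    have u0: "u > 0" using u R by auto
    have "R ^ 3 * \<bar>u - \<mu>\<bar> * B ^ 4 \<le> u ^ 3 * \<bar>u - \<mu>\<bar> * B ^ 4"
      using u R B0 by (intro mult_right_mono power_mono) auto
    also have "\<dots> \<le> 39 ^ 4"
      using lattice_propagator_decay_off_cone[OF u0] by (simp add: \<mu>_def B_def)
    finally have 1: "R ^ 3 * \<bar>u - \<mu>\<bar> * B ^ 4 \<le> 39 ^ 4" .
    have "R ^ 3 * \<rho> * B ^ 4 = R powr (8/3) * B ^ 4"
      using power_mult_powr[OF R(1), of 3 "- (1/3)"] by (simp add: \<rho>_def)
    also have "\<dots> \<le> u powr (8/3) * (24 * u powr (- (2/3))) ^ 4"
      unfolding B_def using u R u0
      by (intro mult_mono power_mono powr_mono2 lattice_propagator_decay) auto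
    also have "\<dots> = 24 ^ 4 * (u powr (8/3) * (u powr (- (2/3))) ^ 4)"
      by (simp add: power_mult_distrib)
    also have "(u powr (- (2/3))) ^ 4 = u powr (- (8/3))"
      using u0 by (simp add: powr_power)
    also have "u powr (8/3) * u powr (- (8/3)) = 1"
      using u0 by (simp add: powr_add[symmetric])
    finally have 2: "R ^ 3 * \<rho> * B ^ 4 \<le> 24 ^ 4" by simp
    \<comment> \<open>Adding the uniform bound, weighted by \<open>\<rho>\<close>, to the off-cone
      bound, weighted by \<open>\<bar>u - \<mu>\<bar>\<close>, gives one estimate valid on both
      sides of the window.\<close>
    define Y where "Y = R ^ 3 * (\<rho> + \<bar>u - \<mu>\<bar>)"
    have Y: "Y > 0" using R \<rho> by (simp add: Y_def add_pos_nonneg)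
    have "Y * B ^ 4 \<le> K"
      using 1 2 by (simp add: Y_def K_def algebra_simps)
    then have B4: "B ^ 4 \<le> K / Y" using Y by (simp add: field_simps)
    have "B ^ 5 = (B ^ 4) powr (5/4)"
    proof (cases "B = 0")
      case False
      then have "B > 0" using B0 by simp
      then show ?thesis using powr_realpow[of B 5] by (simp add: power_powr)
    qed simp
    also have "\<dots> \<le> (K / Y) powr (5/4)"
      using B4 by (intro powr_mono2) auto
    also have "\<dots> = K powr (5/4) * Y powr (- (5/4))"
      using powr_minus_divide[of Y "5/4"] by (simp add: powr_divide)
    also have "Y powr (- (5/4)) = R powr (- (15/4)) * (\<rho> + \<bar>u - \<mu>\<bar>) powr (- (5/4))"
      using R(1) \<rho> by (simp add: Y_def powr_mult power_powr)
    finally show ?thesis by (simp add: B_def mult_ac)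
  qed
  have nz: "\<rho> + \<bar>u - \<mu>\<bar> \<noteq> 0" for u
    using \<rho> by (smt (verit))
  have "integral {R..q} (\<lambda>u. norm (lattice_propagator m u) ^ 5) \<le>
     integral {R..q} (\<lambda>u. K powr (5/4) * R powr (- (15/4)) * (\<rho> + \<bar>u - \<mu>\<bar>) powr (- (5/4)))"
    by (intro integral_le pt integrable_continuous_real continuous_intros continuous_on_lattice_propagator)
      (use nz in auto)
  also have "\<dots> = K powr (5/4) * R powr (- (15/4)) * integral {R..q} (\<lambda>u. (\<rho> + \<bar>u - \<mu>\<bar>) powr (- (5/4)))"
    by (rule integral_mult_right)
  also have "\<dots> \<le> K powr (5/4) * R powr (- (15/4)) * (8 * \<rho> powr (- (1/4)))"
    using integral_shifted_powr_le[OF R(2) \<rho>] by (intro mult_left_mono) auto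
  also have "\<rho> powr (- (1/4)) = R powr (1/12)"
    by (simp add: \<rho>_def powr_powr)
  also have "K powr (5/4) * R powr (- (15/4)) * (8 * R powr (1/12)) = propagator_tail_const * (R powr (- (15/4)) * R powr (1/12))"
    by (simp add: propagator_tail_const_def K_def)
  also have "R powr (- (15/4)) * R powr (1/12) = R powr (- (11/3))"
    by (simp add: powr_add[symmetric])
  finally show ?thesis .
qed

section \<open>Products of five propagators\<close>

text \<open>Differentiation brings down \<open>2 * u * (2 - 2 * cos \<xi>)\<close>, and the cosine
  shifts \<open>m\<close> by one in each direction: the Schroedinger equation at time
  \<open>u\<^sup>2\<close>. A derivative thus costs a factor \<open>u\<close> but no decay.\<close>

lemma lattice_propagator_has_vector_derivative:
  "(lattice_propagator m has_vector_derivative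
     2 * \<i> * of_real u * (2 * lattice_propagator m u - lattice_propagator (m + 1) u - lattice_propagator (m - 1) u)) (at u within S)"
proof -
  define e where "e m u \<xi> = cis (m * \<xi> + u\<^sup>2 * (2 - 2 * cos \<xi>))" for m u \<xi> :: real
  define d where "d u \<xi> = \<i> * of_real (2 * u * (2 - 2 * cos \<xi>)) * e m u \<xi>" for u \<xi>
  have int: "e m u integrable_on cbox (-pi) pi" for m u
    unfolding e_def by (auto intro!: integrable_continuous_real continuous_intros)
  have "((\<lambda>u. integral (cbox (-pi) pi) (e m u)) has_vector_derivative integral (cbox (-pi) pi) (d u)) (at u within UNIV)"
  proof (rule leibniz_rule_vector_derivative)
    fix u \<xi> :: real
    show "((\<lambda>u. e m u \<xi>) has_vector_derivative d u \<xi>) (at u within UNIV)"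
      unfolding e_def d_def
      by (rule has_vector_derivative_cis) (auto intro!: derivative_eq_intros)
  next
    show "continuous_on (UNIV \<times> cbox (-pi) pi) (\<lambda>(u, \<xi>). d u \<xi>)"
      unfolding d_def e_def by (auto simp: split_beta intro!: continuous_intros)
  qed (use int in auto)
  moreover have "d u \<xi> = 2 * \<i> * of_real u * (2 * e m u \<xi> - e (m + 1) u \<xi> - e (m - 1) u \<xi>)" for \<xi>
  proof -
    have 1: "e (m + 1) u \<xi> = e m u \<xi> * cis \<xi>" "e (m - 1) u \<xi> = e m u \<xi> * cis (- \<xi>)"
      by (simp_all only: e_def cis_mult) (simp_all add: algebra_simps)
    have 2: "cis \<xi> + cis (- \<xi>) = of_real (2 * cos \<xi>)"
      by (simp add: complex_eq_iff)
    have "2 * e m u \<xi> - e m u \<xi> * cis \<xi> - e m u \<xi> * cis (- \<xi>) = e m u \<xi> * (2 - (cis \<xi> + cis (- \<xi>)))"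
      by (simp add: algebra_simps)
    then show ?thesis unfolding d_def 1 2 by simp
  qed
  then have "integral (cbox (-pi) pi) (d u) = 2 * \<i> * of_real u * integral (cbox (-pi) pi) (\<lambda>\<xi>. 2 * e m u \<xi> - e (m + 1) u \<xi> - e (m - 1) u \<xi>)"
    by (metis (no_types, lifting) integral_cong integral_mult_right)
  moreover have "integral (cbox (-pi) pi) (\<lambda>\<xi>. 2 * e m u \<xi> - e (m + 1) u \<xi> - e (m - 1) u \<xi>) =
     2 * lattice_propagator m u - lattice_propagator (m + 1) u - lattice_propagator (m - 1) u"
  proof (rule integral_unique)
    have L: "(e m u has_integral lattice_propagator m u) (cbox (-pi) pi)" for m
      using integrable_integral[OF int[of m u]] by (simp add: lattice_propagator_def e_def[abs_def])
    show "((\<lambda>\<xi>. 2 * e m u \<xi> - e (m + 1) u \<xi> - e (m - 1) u \<xi>) has_integral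
        2 * lattice_propagator m u - lattice_propagator (m + 1) u - lattice_propagator (m - 1) u) (cbox (-pi) pi)"
      by (intro has_integral_diff has_integral_mult_right L)
  qed
  ultimately have "((\<lambda>u. integral (cbox (-pi) pi) (e m u)) has_vector_derivative
     2 * \<i> * of_real u * (2 * lattice_propagator m u - lattice_propagator (m + 1) u - lattice_propagator (m - 1) u)) (at u)"
    by (simp only:)
  then have "(lattice_propagator m has_vector_derivative
     2 * \<i> * of_real u * (2 * lattice_propagator m u - lattice_propagator (m + 1) u - lattice_propagator (m - 1) u)) (at u)"
    by (simp add: lattice_propagator_def[abs_def] e_def[abs_def])
  then show ?thesis by (rule has_vector_derivative_at_within)
qed

text \<open>Integration by parts against the tail \<open>h u = \<integral>\<^sub>u\<^sup>T g\<close> turns the decay of the tail into growth of the weighted integral.\<close>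

lemma weighted_integral_from_tail:
  fixes g :: "real \<Rightarrow> real"
  assumes cont: "continuous_on {0<..} g"
    and tail: "\<And>R q. 0 < R \<Longrightarrow> R \<le> q \<Longrightarrow> integral {R..q} g \<le> C * R powr (- (11/3))"
    and C: "C \<ge> 0" and e: "0 < \<epsilon>" "\<epsilon> \<le> T"
  shows "integral {\<epsilon>..T} (\<lambda>u. u ^ 4 * g u) \<le> 13 * C * T powr (1/3)"
proof -
  have gc: "continuous_on {\<epsilon>..T} g" using cont e by (auto intro: continuous_on_subset)
  define h where "h u = integral {u..T} g" for u
  define W where "W u = integral {\<epsilon>..u} (\<lambda>u. u ^ 4 * g u)" for u
  \<comment> \<open>The derivative of \<open>W u + u ^ 4 * h u\<close> is
    \<open>4 * u ^ 3 * h u\<close>, at most \<open>4 * C * u powr (- (2/3))\<close>, whose primitive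
    is subtracted to make \<open>\<Psi>\<close> decreasing. The final 13 is this 12 plus 1 from the
    boundary term at \<open>\<epsilon>\<close>.\<close>
  define \<Psi> where "\<Psi> u = W u + u ^ 4 * h u - 12 * C * u powr (1/3)" for u
  define \<Psi>' where "\<Psi>' u = u ^ 4 * g u + (4 * u ^ 3 * h u + u ^ 4 * (- g u)) - 12 * C * (1/3 * u powr (1/3 - 1))" for u
  have der: "(\<Psi> has_real_derivative \<Psi>' u) (at u within {\<epsilon>..T})" if u: "u \<in> {\<epsilon>..T}" for u
  proof -
    have W: "(W has_real_derivative u ^ 4 * g u) (at u within {\<epsilon>..T})"
      unfolding has_real_derivative_iff_has_vector_derivative W_def
      using u by (intro integral_has_vector_derivative continuous_intros gc)
    have h: "(h has_real_derivative - g u) (at u within {\<epsilon>..T})"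
      unfolding has_real_derivative_iff_has_vector_derivative h_def
      using u by (intro integral_has_vector_derivative' gc)
    show ?thesis
      unfolding \<Psi>_def \<Psi>'_def using u e
      by (auto intro!: derivative_eq_intros W h simp: powr_diff)
  qed
  have "\<Psi> T \<le> \<Psi> \<epsilon>"
  proof (rule DERIV_nonpos_imp_decreasing_open[OF e(2)])
    show "continuous_on {\<epsilon>..T} \<Psi>"
      using der by (meson DERIV_continuous continuous_on_eq_continuous_within)
    fix u assume u: "\<epsilon> < u" "u < T"
    then have u0: "u > 0" using e by simp
    have "u ^ 3 * h u \<le> u ^ 3 * (C * u powr (- (11/3)))"
      unfolding h_def using u e by (intro mult_left_mono tail) auto
    also have "\<dots> = C * u powr (1/3 - 1)"
      using power_mult_powr[OF u0, of 3 "- (11/3)"] by simp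
    finally have "\<Psi>' u \<le> 0" by (simp add: \<Psi>'_def)
    moreover have "(\<Psi> has_real_derivative \<Psi>' u) (at u)"
      using der[of u] u by (simp add: at_within_Icc_at)
    ultimately show "\<exists>y. (\<Psi> has_real_derivative y) (at u) \<and> y \<le> 0" by blast
  qed
  then have "W T \<le> \<epsilon> ^ 4 * h \<epsilon> - 12 * C * \<epsilon> powr (1/3) + 12 * C * T powr (1/3)"
    by (simp add: \<Psi>_def h_def W_def)
  also have "\<epsilon> ^ 4 * h \<epsilon> \<le> \<epsilon> ^ 4 * (C * \<epsilon> powr (- (11/3)))"
    unfolding h_def using e by (intro mult_left_mono tail) auto
  also have "\<epsilon> ^ 4 * (C * \<epsilon> powr (- (11/3))) = C * \<epsilon> powr (1/3)"
    using power_mult_powr[OF e(1), of 4 "- (11/3)"] by simp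
  also have "C * \<epsilon> powr (1/3) \<le> C * T powr (1/3)"
    using e C by (intro mult_left_mono powr_mono2) auto
  finally have "W T \<le> C * T powr (1/3) - 12 * C * \<epsilon> powr (1/3) + 12 * C * T powr (1/3)" by simp
  moreover have "12 * C * \<epsilon> powr (1/3) \<ge> 0" using C by simp
  ultimately show ?thesis by (simp add: W_def)
qed

text \<open>The product is at most the corresponding power of its largest factor, which is one of
  the summands.\<close>

lemma prod_le_sum_power_card:
  fixes z :: "'a \<Rightarrow> real"
  assumes I: "finite I" "I \<noteq> {}" and z: "\<And>i. i \<in> I \<Longrightarrow> z i \<ge> 0"
  shows "(\<Prod>i\<in>I. z i) \<le> (\<Sum>i\<in>I. z i ^ card I)"
proof -
  have "Max (z ` I) \<in> z ` I" using I by (intro Max_in) auto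
  then obtain k where "k \<in> I" "z k = Max (z ` I)" by auto
  then have k: "k \<in> I" "\<And>i. i \<in> I \<Longrightarrow> z i \<le> z k" using I by auto
  have "(\<Prod>i\<in>I. z i) \<le> (\<Prod>i\<in>I. z k)"
    using k z by (intro prod_mono) auto
  also have "\<dots> = z k ^ card I" by simp
  also have "\<dots> \<le> (\<Sum>i\<in>I. z i ^ card I)"
    using I k z by (intro member_le_sum) auto
  finally show ?thesis .
qed

definition propagator_product :: "('d::finite \<Rightarrow> real) \<Rightarrow> real \<Rightarrow> complex"
  where "propagator_product m u = (\<Prod>j\<in>UNIV. lattice_propagator (m j) u)"

definition propagator_product_deriv :: "('d::finite \<Rightarrow> real) \<Rightarrow> real \<Rightarrow> complex"
  where "propagator_product_deriv m u = (\<Sum>i\<in>UNIV.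
     2 * \<i> * of_real u * (2 * lattice_propagator (m i) u - lattice_propagator (m i + 1) u - lattice_propagator (m i - 1) u) *
     (\<Prod>j\<in>UNIV - {i}. lattice_propagator (m j) u))"

text \<open>The neighbours \<open>m j + 1\<close> and \<open>m j - 1\<close> are included because
  they occur in the derivative, so one majorant serves the product and its derivative. The exponent
  5 matches the number of factors in dimension five.\<close>

definition propagator_majorant :: "('d::finite \<Rightarrow> real) \<Rightarrow> real \<Rightarrow> real"
  where "propagator_majorant m u = (\<Sum>j\<in>UNIV. norm (lattice_propagator (m j) u) ^ 5 +
     norm (lattice_propagator (m j + 1) u) ^ 5 + norm (lattice_propagator (m j - 1) u) ^ 5)"

lemma propagator_product_has_vector_derivative:
  "(propagator_product m has_vector_derivative propagator_product_deriv m u) (at u within S)"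
proof -
  have "((\<lambda>u. \<Prod>j\<in>UNIV. lattice_propagator (m j) u) has_derivative
     (\<lambda>y. \<Sum>i\<in>UNIV. y *\<^sub>R (2 * \<i> * of_real u * (2 * lattice_propagator (m i) u - lattice_propagator (m i + 1) u - lattice_propagator (m i - 1) u)) *
     (\<Prod>j\<in>UNIV - {i}. lattice_propagator (m j) u))) (at u within S)"
    by (rule has_derivative_prod) (rule lattice_propagator_has_vector_derivative[unfolded has_vector_derivative_def])
  then show ?thesis
    by (simp add: has_vector_derivative_def propagator_product_def[abs_def] propagator_product_deriv_def scaleR_sum_right)
qed

lemma continuous_on_propagator_product: "continuous_on S (propagator_product m)"
  unfolding propagator_product_def[abs_def]
  by (intro continuous_on_prod continuous_on_lattice_propagator)

lemma continuous_on_propagator_majorant: "continuous_on S (propagator_majorant m)"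
  unfolding propagator_majorant_def[abs_def]
  by (intro continuous_intros continuous_on_lattice_propagator)

lemma norm_propagator_product_le_majorant:
  "norm (propagator_product (m :: 5 \<Rightarrow> real) u) \<le> propagator_majorant m u"
proof -
  have "norm (propagator_product m u) \<le> (\<Sum>j\<in>UNIV. norm (lattice_propagator (m j) u) ^ card (UNIV :: 5 set))"
    unfolding propagator_product_def prod_norm[symmetric] by (rule prod_le_sum_power_card) auto
  also have "\<dots> \<le> propagator_majorant m u"
    unfolding propagator_majorant_def by (intro sum_mono) simp
  finally show ?thesis .
qed

text \<open>Each of the five Leibniz terms carries \<open>2 * u\<close> and at most 2 + 1 + 1
  products in which one factor is possibly shifted; hence 40 = 5 * 2 * 4.\<close>

lemma norm_propagator_product_deriv_le:
  assumes "u \<ge> 0"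
  shows "norm (propagator_product_deriv (m :: 5 \<Rightarrow> real) u) \<le> 40 * u * propagator_majorant m u"
proof -
  let ?b = "\<lambda>m. norm (lattice_propagator m u)"
  let ?E = "propagator_majorant m u"
  have P: "?b a * (\<Prod>j\<in>UNIV - {i}. ?b (m j)) \<le> ?E" if a: "a = m i \<or> a = m i + 1 \<or> a = m i - 1" for a i
  proof -
    define z where "z j = (if j = i then ?b a else ?b (m j))" for j
    have "?b a * (\<Prod>j\<in>UNIV - {i}. ?b (m j)) = (\<Prod>j\<in>UNIV. z j)"
      by (subst (2) prod.remove[of _ i]) (auto simp: z_def intro!: prod.cong)
    also have "\<dots> \<le> (\<Sum>j\<in>UNIV. z j ^ card (UNIV :: 5 set))"
      by (rule prod_le_sum_power_card) (auto simp: z_def)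
    also have "\<dots> \<le> ?E"
      unfolding propagator_majorant_def
      by (intro sum_mono) (use a in \<open>auto simp: z_def\<close>)
    finally show ?thesis .
  qed
  have "norm (propagator_product_deriv m u) \<le> (\<Sum>i\<in>(UNIV :: 5 set). 8 * u * ?E)"
    unfolding propagator_product_deriv_def
  proof (rule sum_norm_le)
    fix i :: 5
    let ?Q = "\<Prod>j\<in>UNIV - {i}. ?b (m j)"
    have Q: "?Q \<ge> 0" by (intro prod_nonneg) auto
    have "norm (2 * lattice_propagator (m i) u - lattice_propagator (m i + 1) u - lattice_propagator (m i - 1) u)
        \<le> norm (2 * lattice_propagator (m i) u - lattice_propagator (m i + 1) u) + ?b (m i - 1)"
      by (rule norm_triangle_ineq4)
    also have "\<dots> \<le> norm (2 * lattice_propagator (m i) u) + ?b (m i + 1) + ?b (m i - 1)"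
      by (intro add_right_mono norm_triangle_ineq4)
    finally have "norm (2 * lattice_propagator (m i) u - lattice_propagator (m i + 1) u - lattice_propagator (m i - 1) u)
        \<le> 2 * ?b (m i) + ?b (m i + 1) + ?b (m i - 1)" by (simp add: norm_mult)
    then have "norm (2 * lattice_propagator (m i) u - lattice_propagator (m i + 1) u - lattice_propagator (m i - 1) u) * ?Q
        \<le> (2 * ?b (m i) + ?b (m i + 1) + ?b (m i - 1)) * ?Q"
      using Q by (rule mult_right_mono)
    also have "\<dots> = 2 * (?b (m i) * ?Q) + ?b (m i + 1) * ?Q + ?b (m i - 1) * ?Q"
      by (simp add: algebra_simps)
    also have "\<dots> \<le> 2 * ?E + ?E + ?E"
      by (intro add_mono mult_left_mono P) auto
    finally have "2 * u * (norm (2 * lattice_propagator (m i) u - lattice_propagator (m i + 1) u - lattice_propagator (m i - 1) u) * ?Q) \<le> 2 * u * (4 * ?E)"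
      using assms by (intro mult_left_mono) auto
    then show "norm (2 * \<i> * of_real u * (2 * lattice_propagator (m i) u - lattice_propagator (m i + 1) u - lattice_propagator (m i - 1) u) *
     (\<Prod>j\<in>UNIV - {i}. lattice_propagator (m j) u)) \<le> 8 * u * ?E"
      using assms by (simp add: norm_mult prod_norm mult.assoc)
  qed
  also have "\<dots> = 40 * u * ?E" by simp
  finally show ?thesis .
qed

lemma integral_propagator_majorant_le:
  assumes "0 < R" "R \<le> q"
  shows "integral {R..q} (propagator_majorant (m :: 5 \<Rightarrow> real)) \<le> 15 * propagator_tail_const * R powr (- (11/3))"
proof -
  let ?B = "\<lambda>m u. norm (lattice_propagator m u) ^ 5"
  let ?I = "\<lambda>m. integral {R..q} (?B m)"
  have int: "?B m integrable_on {R..q}" for m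
    by (intro integrable_continuous_real continuous_intros continuous_on_lattice_propagator)
  have "(propagator_majorant m has_integral (\<Sum>j\<in>UNIV. ?I (m j) + ?I (m j + 1) + ?I (m j - 1))) {R..q}"
    unfolding propagator_majorant_def[abs_def]
    by (intro has_integral_sum has_integral_add integrable_integral int) auto
  then have "integral {R..q} (propagator_majorant m) = (\<Sum>j\<in>UNIV. ?I (m j) + ?I (m j + 1) + ?I (m j - 1))"
    by (rule integral_unique)
  also have "\<dots> \<le> (\<Sum>j\<in>(UNIV :: 5 set). 3 * (propagator_tail_const * R powr (- (11/3))))"
  proof (rule sum_mono)
    fix j show "?I (m j) + ?I (m j + 1) + ?I (m j - 1) \<le> 3 * (propagator_tail_const * R powr (- (11/3)))"
      using lattice_propagator_L5_tail[OF assms, of "m j"] lattice_propagator_L5_tail[OF assms, of "m j + 1"]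
        lattice_propagator_L5_tail[OF assms, of "m j - 1"] by linarith
  qed
  also have "\<dots> = 15 * propagator_tail_const * R powr (- (11/3))" by simp
  finally show ?thesis .
qed

text \<open>The exponent is deliberately weaker than the available -10/3 for large \<open>u\<close>:
  a single power then holds for all \<open>u > 0\<close>, \<open>u\<^sup>2\<close> times it is
  integrable at 0, and \<open>u ^ 3\<close> times it is exactly \<open>u powr (1/3)\<close>, the
  growth allowed in the integration by parts.\<close>

lemma norm_propagator_product_le_powr:
  assumes u: "u > 0"
  shows "norm (propagator_product (m :: 5 \<Rightarrow> real) u) \<le> 24 ^ 5 * u powr (- (8/3))"
proof -
  have b: "norm (lattice_propagator k u) \<le> 24 * u powr (- (8/15))" for k
  proof (cases "u \<ge> 1")
    case True
    have "u powr (- (2/3)) \<le> u powr (- (8/15))" using True by (intro powr_mono) auto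
    then show ?thesis using lattice_propagator_decay[OF u, of k] by linarith
  next
    case False
    have "1 \<le> u powr (- (8/15))" using False u by (simp add: powr_minus one_le_inverse_iff powr_le1)
    then show ?thesis using norm_lattice_propagator_le[of k u] pi_less_4 by linarith
  qed
  have "norm (propagator_product m u) \<le> (\<Prod>j\<in>(UNIV :: 5 set). 24 * u powr (- (8/15)))"
    unfolding propagator_product_def prod_norm[symmetric] by (rule prod_mono) (use b in auto)
  also have "\<dots> = 24 ^ 5 * u powr (- (8/3))" using u by (simp add: power_mult_distrib powr_power)
  finally show ?thesis .
qed

text \<open>The cutoffs stay free, since only the limit of the truncated integrals represents the
  kernel. After division by \<open>T ^ 4\<close> every contribution from below \<open>T\<close> is
  of size \<open>T powr (1/3) / T ^ 4\<close>, the same as the tail beyond \<open>T\<close>.\<close>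

lemma oscillatory_propagator_integral_bound:
  shows "\<exists>C>0. \<forall>(m :: 5 \<Rightarrow> real) \<epsilon> T n. 0 < \<epsilon> \<longrightarrow> \<epsilon> \<le> T \<longrightarrow> T \<le> n \<longrightarrow>
    norm (integral {\<epsilon>..n} (\<lambda>u. cis (T ^ 4 / (4 * u\<^sup>2)) * propagator_product m u)) \<le> C * T powr (- (11/3))"
proof (intro exI conjI allI impI)
  define C0 K where "C0 = 15 * propagator_tail_const" and "K = (24 ^ 5 :: real)"
  have C0: "C0 > 0" using propagator_tail_const_pos by (simp add: C0_def)
  have K: "K > 0" by (simp add: K_def)
  \<comment> \<open>In order: the range beyond \<open>T\<close>, the boundary terms at
    \<open>\<epsilon>\<close> and \<open>T\<close>, and the accumulated error
    \<open>D T\<close>.\<close>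
  define C where "C = C0 + 2 * K + 2 * K + 2 * (9 * K + 40 * 13 * C0)"
  show "C > 0" using C0 K by (simp add: C_def)
  fix m :: "5 \<Rightarrow> real" and \<epsilon> T n :: real
  assume e: "0 < \<epsilon>" "\<epsilon> \<le> T" and n: "T \<le> n"
  have T: "T > 0" using e by simp
  define F where "F = propagator_product m"
  define E where "E = propagator_majorant m"
  define c where "c u = cis (T ^ 4 / (4 * u\<^sup>2))" for u
  have Fc: "continuous_on S F" for S unfolding F_def by (rule continuous_on_propagator_product)
  have Ec: "continuous_on S E" for S unfolding E_def by (rule continuous_on_propagator_majorant)
  have hc: "continuous_on S (\<lambda>u. c u * F u)" if "S \<subseteq> {0<..}" for S
    unfolding c_def using that by (intro continuous_intros Fc) auto
  have int: "(\<lambda>u. c u * F u) integrable_on {a..b}" if "a > 0" for a b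
    by (rule integrable_continuous_real, rule hc) (use that in auto)
  have E0: "E u \<ge> 0" for u by (simp add: E_def propagator_majorant_def sum_nonneg)
  have FE: "norm (F u) \<le> E u" for u unfolding F_def E_def by (rule norm_propagator_product_le_majorant)
  have FK: "norm (F u) \<le> K * u powr (- (8/3))" if "u > 0" for u
    unfolding F_def K_def by (rule norm_propagator_product_le_powr[OF that])
  have tail: "integral {R..q} E \<le> C0 * R powr (- (11/3))" if "0 < R" "R \<le> q" for R q
    unfolding E_def C0_def by (rule integral_propagator_majorant_le[OF that])
  have T4: "T powr (1/3) / T ^ 4 = T powr (- (11/3))"
  proof -
    have "T ^ 4 = T powr 4" using T by simp
    then show ?thesis by (simp only: powr_diff[symmetric]) simp
  qed
  have far: "norm (integral {T..n} (\<lambda>u. c u * F u)) \<le> C0 * T powr (- (11/3))"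
  proof -
    have "norm (integral {T..n} (\<lambda>u. c u * F u)) \<le> integral {T..n} E"
      by (rule integral_norm_bound_integral) (use int T FE in \<open>auto intro!: integrable_continuous_real Ec simp: norm_mult c_def\<close>)
    also have "\<dots> \<le> C0 * T powr (- (11/3))" by (rule tail[OF T n])
    finally show ?thesis .
  qed
  \<comment> \<open>The phase \<open>T ^ 4 / (4 * u\<^sup>2)\<close> has derivative
    \<open>- (T ^ 4) / (2 * u ^ 3)\<close>; dividing by \<open>\<i>\<close> times it gives this
    weight.\<close>
  define P where "P u = 2 * \<i> / of_real (T ^ 4) * (of_real (u ^ 3) * (c u * F u))" for u
  define W where "W u = integral {\<epsilon>..u} (\<lambda>u. u ^ 4 * E u)" for u
  \<comment> \<open>A primitive of the error bound: \<open>3 * u\<^sup>2 * norm (F u)\<close>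
    contributes \<open>9 * K * u powr (1/3)\<close>, and \<open>u ^ 3\<close> times the derivative
    of \<open>F\<close> contributes \<open>40 * W u\<close>.\<close>
  define D where "D u = 2 / T ^ 4 * (9 * K * u powr (1/3) + 40 * W u)" for u
  have near: "norm (integral {\<epsilon>..T} (\<lambda>u. c u * F u)) \<le> norm (P \<epsilon>) + norm (P T) + (D T - D \<epsilon>)"
  proof (rule norm_integral_by_parts[OF e(2)])
    show "continuous_on {\<epsilon>..T} (\<lambda>u. c u * F u)" by (rule hc) (use e in auto)
    fix u assume u: "u \<in> {\<epsilon>..T}"
    have u0: "u > 0" using u e by simp
    define F' where "F' = propagator_product_deriv m u"
    define R where "R u = 2 * \<i> / of_real (T ^ 4) * (c u * (of_real (3 * u\<^sup>2) * F u + of_real (u ^ 3) * propagator_product_deriv m u))" for u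
    have c': "(c has_vector_derivative \<i> * of_real (- (T ^ 4) / (2 * u ^ 3)) * c u) (at u within {\<epsilon>..T})"
      unfolding c_def[abs_def]
      by (rule has_vector_derivative_cis)
        (use u0 in \<open>auto intro!: derivative_eq_intros simp: power2_eq_square power3_eq_cube field_simps\<close>)
    have p': "((\<lambda>u. of_real (u ^ 3) :: complex) has_vector_derivative of_real (3 * u\<^sup>2)) (at u within {\<epsilon>..T})"
      by (intro has_vector_derivative_of_real) (auto intro!: derivative_eq_intros)
    have F': "(F has_vector_derivative F') (at u within {\<epsilon>..T})"
      unfolding F_def F'_def by (rule propagator_product_has_vector_derivative)
    have "(P has_vector_derivative 2 * \<i> / of_real (T ^ 4) *
       (of_real (u ^ 3) * (c u * F' + \<i> * of_real (- (T ^ 4) / (2 * u ^ 3)) * c u * F u) + of_real (3 * u\<^sup>2) * (c u * F u))) (at u within {\<epsilon>..T})"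
      unfolding P_def[abs_def]
      by (intro has_vector_derivative_mult_right has_vector_derivative_mult c' p' F')
    also have "2 * \<i> / of_real (T ^ 4) *
       (of_real (u ^ 3) * (c u * F' + \<i> * of_real (- (T ^ 4) / (2 * u ^ 3)) * c u * F u) + of_real (3 * u\<^sup>2) * (c u * F u))
       = c u * F u + R u"
      using u0 T by (simp add: R_def F'_def field_simps)
    finally show "(P has_vector_derivative c u * F u + R u) (at u within {\<epsilon>..T})" .
    have W': "(W has_real_derivative u ^ 4 * E u) (at u within {\<epsilon>..T})"
      unfolding has_real_derivative_iff_has_vector_derivative W_def
      using u by (intro integral_has_vector_derivative continuous_intros Ec)
    have "(D has_real_derivative 2 / T ^ 4 * (9 * K * (1/3 * u powr (1/3 - 1)) + 40 * (u ^ 4 * E u))) (at u within {\<epsilon>..T})"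
      unfolding D_def[abs_def] using u0
      by (intro DERIV_cmult DERIV_add W') (auto intro!: derivative_eq_intros simp: powr_diff)
    then show "(D has_vector_derivative 2 / T ^ 4 * (3 * K * u powr (- (2/3)) + 40 * (u ^ 4 * E u))) (at u within {\<epsilon>..T})"
      by (simp add: has_real_derivative_iff_has_vector_derivative)
    have "norm (R u) = 2 / T ^ 4 * norm (of_real (3 * u\<^sup>2) * F u + of_real (u ^ 3) * propagator_product_deriv m u)"
      using T by (simp add: R_def norm_mult norm_divide c_def norm_power)
    also have "\<dots> \<le> 2 / T ^ 4 * (3 * u\<^sup>2 * norm (F u) + u ^ 3 * norm (propagator_product_deriv m u))"
      using u0 T by (intro mult_left_mono order_trans[OF norm_triangle_ineq]) (auto simp: norm_mult norm_power)
    also have "\<dots> \<le> 2 / T ^ 4 * (3 * u\<^sup>2 * (K * u powr (- (8/3))) + u ^ 3 * (40 * u * E u))"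
      unfolding E_def using u0 T
      by (intro mult_left_mono add_mono FK norm_propagator_product_deriv_le) auto
    also have "3 * u\<^sup>2 * (K * u powr (- (8/3))) = 3 * K * u powr (- (2/3))"
      using power_mult_powr[OF u0, of 2 "- (8/3)"] by simp
    also have "u ^ 3 * (40 * u * E u) = 40 * (u ^ 4 * E u)"
      by (simp add: power3_eq_cube power4_eq_xxxx)
    finally show "norm (R u) \<le> 2 / T ^ 4 * (3 * K * u powr (- (2/3)) + 40 * (u ^ 4 * E u))" .
  qed
  have Pb: "norm (P u) \<le> 2 * K * T powr (- (11/3))" if u: "0 < u" "u \<le> T" for u
  proof -
    have "norm (P u) = 2 / T ^ 4 * (u ^ 3 * norm (F u))"
      using T u by (simp add: P_def norm_mult norm_divide c_def norm_power)
    also have "\<dots> \<le> 2 / T ^ 4 * (u ^ 3 * (K * u powr (- (8/3))))"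
      using T u by (intro mult_left_mono FK) auto
    also have "u ^ 3 * (K * u powr (- (8/3))) = K * u powr (1/3)"
      using power_mult_powr[OF u(1), of 3 "- (8/3)"] by simp
    also have "2 / T ^ 4 * (K * u powr (1/3)) \<le> 2 / T ^ 4 * (K * T powr (1/3))"
      using T u K by (intro mult_left_mono powr_mono2) auto
    also have "\<dots> = 2 * K * (T powr (1/3) / T ^ 4)" by simp
    finally show ?thesis unfolding T4 .
  qed
  have "W T \<le> 13 * C0 * T powr (1/3)"
    unfolding W_def using C0 e by (intro weighted_integral_from_tail Ec tail) auto
  then have "D T \<le> 2 / T ^ 4 * (9 * K * T powr (1/3) + 40 * (13 * C0 * T powr (1/3)))"
    unfolding D_def using T by (intro mult_left_mono add_left_mono) auto
  also have "\<dots> = 2 * (9 * K + 40 * 13 * C0) * (T powr (1/3) / T ^ 4)"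
    by (simp add: algebra_simps add_divide_distrib)
  finally have DT: "D T \<le> 2 * (9 * K + 40 * 13 * C0) * T powr (- (11/3))" unfolding T4 .
  have De: "D \<epsilon> \<ge> 0"
    using e T K by (simp add: D_def W_def)
  have "integral {\<epsilon>..n} (\<lambda>u. c u * F u) = integral {\<epsilon>..T} (\<lambda>u. c u * F u) + integral {T..n} (\<lambda>u. c u * F u)"
    using e n int[OF e(1)] by (simp add: Henstock_Kurzweil_Integration.integral_combine)
  then have "norm (integral {\<epsilon>..n} (\<lambda>u. c u * F u)) \<le> norm (integral {\<epsilon>..T} (\<lambda>u. c u * F u)) + norm (integral {T..n} (\<lambda>u. c u * F u))"
    by (simp add: norm_triangle_ineq)
  also have "\<dots> \<le> 2 * K * T powr (- (11/3)) + 2 * K * T powr (- (11/3)) + 2 * (9 * K + 40 * 13 * C0) * T powr (- (11/3)) + C0 * T powr (- (11/3))"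
    using near far DT De Pb[of \<epsilon>] Pb[of T] e T by linarith
  also have "\<dots> = C * T powr (- (11/3))" by (simp add: C_def algebra_simps)
  finally show "norm (integral {\<epsilon>..n} (\<lambda>u. cis (T ^ 4 / (4 * u\<^sup>2)) * propagator_product m u)) \<le> C * T powr (- (11/3))"
    by (simp add: c_def F_def)
qed

section \<open>The Fresnel representation of the half-wave kernel\<close>

definition fresnel :: "real \<Rightarrow> complex"
  where "fresnel V = integral {0..V} (\<lambda>v. cis (v\<^sup>2))"

lemma cis_square_integrable: "(\<lambda>v. cis (v\<^sup>2)) integrable_on {a..b}"
  by (intro integrable_continuous_real continuous_intros)

lemma fresnel_split:
  assumes "0 \<le> a" "a \<le> b"
  shows "fresnel b = fresnel a + integral {a..b} (\<lambda>v. cis (v\<^sup>2))"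
  unfolding fresnel_def
  using Henstock_Kurzweil_Integration.integral_combine[OF assms cis_square_integrable] by simp

lemma fresnel_diff_bound:
  assumes "0 < a" "a \<le> b"
  shows "norm (fresnel b - fresnel a) \<le> 2 / a"
proof -
  have "norm (integral {a..b} (\<lambda>v. cis (v\<^sup>2))) \<le> 4 / (2 * a)"
    by (rule van_der_Corput_first_derivative[where g = "\<lambda>v. 2 * v" and g' = "\<lambda>_. 2"])
      (use assms in \<open>auto intro!: derivative_eq_intros\<close>)
  then show ?thesis using fresnel_split[of a b] assms by simp
qed

text \<open>This secures a nonzero limit without evaluating it. Integrating
  \<open>sin (v\<^sup>2)\<close> by parts with \<open>1 - cos (v\<^sup>2)\<close> as the primitive
  of \<open>2 * v * sin (v\<^sup>2)\<close> leaves the nonnegative integrand \<open>r\<close>, which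
  is at least \<open>1 / (2 * pi)\<close> for \<open>v\<^sup>2\<close> between \<open>pi / 2\<close>
  and \<open>pi\<close>.\<close>

lemma Im_fresnel_lower_bound:
  "\<exists>c>0. \<forall>V\<ge>2. Im (fresnel V) \<ge> c"
proof (intro exI conjI allI impI)
  define p q where "p = sqrt (pi / 2)" and "q = sqrt pi"
  define c where "c = (q - p) / (2 * pi)"
  have pq: "0 < p" "p < q" by (auto simp: p_def q_def)
  have p2: "p\<^sup>2 = pi / 2" "q\<^sup>2 = pi" by (auto simp: p_def q_def)
  have p1: "p > 1" using pi_gt3 by (simp add: p_def real_less_rsqrt)
  have q2: "q \<le> 2" using pi_less_4 by (simp add: q_def real_le_lsqrt)
  have c: "c > 0" using pq by (simp add: c_def)
  have "q - p \<le> 1 * (2 * pi)" using q2 p1 pi_gt3 by linarith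
  then have c1: "c \<le> 1" unfolding c_def by (simp add: divide_le_eq)
  show "c / 2 > 0" using c by simp
  fix V :: real assume V: "V \<ge> 2"
  \<comment> \<open>The start at \<open>\<delta>\<close> avoids the singular quotient at 0. It costs
    at most \<open>\<delta>\<close> for the omitted piece and \<open>\<delta> / 2\<close> for
    \<open>Q \<delta>\<close>, together \<open>c / 2\<close>.\<close>
  define \<delta> where "\<delta> = c / 3"
  have \<delta>: "0 < \<delta>" "\<delta> < 1" using c c1 by (auto simp: \<delta>_def)
  define Q where "Q v = (1 - cos (v\<^sup>2)) / (2 * v)" for v :: real
  define r where "r v = (1 - cos (v\<^sup>2)) / (2 * v\<^sup>2)" for v :: real
  have r0: "r v \<ge> 0" for v by (simp add: r_def)
  have rc: "continuous_on S r" if "S \<subseteq> {0<..}" for S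
    unfolding r_def using that by (intro continuous_intros) auto
  have rint: "r integrable_on {a..b}" if "a > 0" for a b
    by (rule integrable_continuous_real, rule rc) (use that in auto)
  have "((\<lambda>v. sin (v\<^sup>2) - r v) has_integral (Q V - Q \<delta>)) {\<delta>..V}"
  proof (rule fundamental_theorem_of_calculus)
    show "\<delta> \<le> V" using \<delta> V by simp
    fix v assume "v \<in> {\<delta>..V}"
    then have v: "v > 0" using \<delta> by simp
    have "(Q has_real_derivative (sin (v\<^sup>2) - r v)) (at v within {\<delta>..V})"
      unfolding Q_def[abs_def] r_def using v
      by (auto intro!: derivative_eq_intros simp: power2_eq_square field_simps)
    then show "(Q has_vector_derivative (sin (v\<^sup>2) - r v)) (at v within {\<delta>..V})"
      by (simp add: has_real_derivative_iff_has_vector_derivative)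
  qed
  moreover have "(r has_integral integral {\<delta>..V} r) {\<delta>..V}"
    using rint \<delta> by (intro integrable_integral) auto
  ultimately have "((\<lambda>v. sin (v\<^sup>2) - r v + r v) has_integral (Q V - Q \<delta> + integral {\<delta>..V} r)) {\<delta>..V}"
    by (rule has_integral_add)
  then have I1: "integral {\<delta>..V} (\<lambda>v. sin (v\<^sup>2)) = Q V - Q \<delta> + integral {\<delta>..V} r"
    by (intro integral_unique) simp
  have "integral {p..q} (\<lambda>_. 1 / (2 * pi)) \<le> integral {p..q} r"
  proof (rule integral_le)
    fix v assume v: "v \<in> {p..q}"
    then have vv: "p\<^sup>2 \<le> v\<^sup>2" "v\<^sup>2 \<le> q\<^sup>2" using pq by (auto intro!: power_mono)
    then have "cos (v\<^sup>2) \<le> cos (pi / 2)"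
      unfolding p2 by (intro cos_monotone_0_pi_le) auto
    then have "1 \<le> 1 - cos (v\<^sup>2)" by simp
    then show "1 / (2 * pi) \<le> r v"
      unfolding r_def using vv v pq unfolding p2 by (intro frac_le) auto
  qed (use rint pq in auto)
  then have "c \<le> integral {p..q} r" using pq by (simp add: c_def)
  also have "\<dots> \<le> integral {\<delta>..V} r"
    by (rule integral_subset_le) (use p1 q2 V \<delta> rint pq r0 in auto)
  finally have rge: "c \<le> integral {\<delta>..V} r" .
  have QV: "Q V \<ge> 0" using V by (simp add: Q_def)
  have Qd: "Q \<delta> \<le> \<delta> / 2"
  proof -
    have "1 - cos (\<delta>\<^sup>2) \<le> \<delta>\<^sup>2 * 1"
    proof -
      have "norm (cos (\<delta>\<^sup>2) - cos 0) \<le> 1 * norm (\<delta>\<^sup>2 - 0)"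
        by (rule field_differentiable_bound[of UNIV cos "\<lambda>x. - sin x"])
          (auto intro!: derivative_eq_intros)
      then show ?thesis by simp
    qed
    then have "Q \<delta> \<le> \<delta>\<^sup>2 / (2 * \<delta>)"
      unfolding Q_def using \<delta> by (intro divide_right_mono) auto
    then show ?thesis using \<delta> by (simp add: power2_eq_square)
  qed
  have Imi: "Im (integral {a..b} (\<lambda>v. cis (v\<^sup>2))) = integral {a..b} (\<lambda>v. sin (v\<^sup>2))" for a b
    using integral_linear[OF cis_square_integrable bounded_linear_Im, of a b] by (simp add: o_def)
  have "norm (fresnel \<delta>) \<le> 1 * (\<delta> - 0)"
    unfolding fresnel_def by (rule integral_bound) (use \<delta> in \<open>auto intro!: continuous_intros\<close>)
  then have "Im (fresnel \<delta>) \<ge> - \<delta>"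
    using abs_Im_le_cmod[of "fresnel \<delta>"] by (simp add: abs_le_iff)
  moreover have "Im (fresnel V) = Im (fresnel \<delta>) + integral {\<delta>..V} (\<lambda>v. sin (v\<^sup>2))"
    using fresnel_split[of \<delta> V] \<delta> V by (simp add: Imi)
  ultimately show "Im (fresnel V) \<ge> c / 2"
    using I1 rge QV Qd unfolding \<delta>_def by linarith
qed

lemma fresnel_limit:
  obtains L where "L \<noteq> 0" "(fresnel \<longlongrightarrow> L) at_top"
proof -
  have "Cauchy (\<lambda>n. fresnel (real (Suc n)))"
  proof (rule metric_CauchyI)
    fix e :: real assume e: "e > 0"
    obtain M :: nat where M: "real M > 2 / e" using reals_Archimedean2 by blast
    have *: "dist (fresnel (real (Suc a))) (fresnel (real (Suc b))) < e" if "M \<le> a" "a \<le> b" for a b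
    proof -
      have "dist (fresnel (real (Suc a))) (fresnel (real (Suc b))) \<le> 2 / real (Suc a)"
        using fresnel_diff_bound[of "real (Suc a)" "real (Suc b)"] that by (simp add: dist_norm norm_minus_commute)
      also have "2 / real (Suc a) < e"
      proof -
        have "2 / e < real (Suc a)" using M that by linarith
        then show ?thesis using e by (simp add: field_simps)
      qed
      finally show ?thesis .
    qed
    show "\<exists>M. \<forall>m\<ge>M. \<forall>n\<ge>M. dist (fresnel (real (Suc m))) (fresnel (real (Suc n))) < e"
    proof (intro exI allI impI)
      fix m n assume "m \<ge> M" "n \<ge> M"
      then show "dist (fresnel (real (Suc m))) (fresnel (real (Suc n))) < e"
        using *[of m n] *[of n m] by (cases "m \<le> n") (auto simp: dist_commute)
    qed
  qed
  then obtain L where L: "(\<lambda>n. fresnel (real (Suc n))) \<longlonglongrightarrow> L"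
    using Cauchy_convergent convergent_def by blast
  have bnd: "norm (fresnel V - L) \<le> 2 / V" if V: "V > 0" for V
  proof -
    have "(\<lambda>n. norm (fresnel V - fresnel (real (Suc n)))) \<longlonglongrightarrow> norm (fresnel V - L)"
      by (intro tendsto_intros L)
    moreover have "eventually (\<lambda>n. norm (fresnel V - fresnel (real (Suc n))) \<le> 2 / V) sequentially"
      using eventually_ge_at_top[of "nat \<lceil>V\<rceil>"]
    proof eventually_elim
      case (elim n)
      then have "V \<le> real (Suc n)" by linarith
      then show ?case using fresnel_diff_bound[OF V, of "real (Suc n)"] by (simp add: norm_minus_commute)
    qed
    ultimately show ?thesis by (rule tendsto_upperbound) auto
  qed
  have "((\<lambda>V. fresnel V - L) \<longlongrightarrow> 0) at_top"
  proof (rule Lim_null_comparison)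
    show "eventually (\<lambda>V. norm (fresnel V - L) \<le> 2 / V) at_top"
      using eventually_gt_at_top[of 0] by eventually_elim (rule bnd)
    show "((\<lambda>V::real. 2 / V) \<longlongrightarrow> 0) at_top"
      by real_asymp
  qed
  then have lim: "(fresnel \<longlongrightarrow> L) at_top" by (simp add: Lim_null[of fresnel])
  obtain c where c: "c > 0" "\<And>V. V \<ge> 2 \<Longrightarrow> Im (fresnel V) \<ge> c"
    using Im_fresnel_lower_bound by blast
  have "Im L \<ge> c"
    by (rule tendsto_lowerbound[OF tendsto_Im[OF lim] eventually_mono[OF eventually_ge_at_top[of 2]]])
      (use c in auto)
  then have "L \<noteq> 0" using c by auto
  then show ?thesis using that lim by blast
qed

text \<open>Averaging with the reflection \<open>u \<mapsto> k / u\<close>, which preserves the phase, makes the weight the derivative of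
  \<open>w * u - t / (2 * u)\<close>, whose square is the phase up to the constant \<open>t * w\<close>.\<close>

lemma Glasser_fresnel:
  assumes t: "t > 0" and w: "w > 0" and k: "k = t / (2 * w)" and n: "n > 0" "k \<le> n\<^sup>2"
  shows "integral {k / n..n} (\<lambda>u. cis (t\<^sup>2 / (4 * u\<^sup>2) + w\<^sup>2 * u\<^sup>2)) =
     cis (t * w) / of_real w * fresnel (w * n - t / (2 * n))"
proof -
  define h where "h u = cis (t\<^sup>2 / (4 * u\<^sup>2) + w\<^sup>2 * u\<^sup>2)" for u
  \<comment> \<open>\<open>s\<close> is the fixed point of the reflection, the stationary point of
    the phase and the zero of \<open>v\<close>, so the resulting Fresnel integral starts at
    0.\<close>
  define s where "s = sqrt k"
  have k0: "k > 0" using t w k by simp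
  have s: "s > 0" "s * s = k" using k0 by (auto simp: s_def)
  have sn: "s \<le> n" using n unfolding s_def by (intro real_le_lsqrt) auto
  have kn: "k / n \<le> s"
  proof -
    have "k \<le> s * n" using s sn by (metis less_imp_le mult_left_mono)
    then show ?thesis using n by (simp add: divide_le_eq)
  qed
  have kn0: "k / n > 0" using k0 n by simp
  have hc: "continuous_on S h" if "S \<subseteq> {0<..}" for S
    unfolding h_def using that by (intro continuous_intros) auto
  have hint: "h integrable_on {a..b}" if "a > 0" for a b
    by (rule integrable_continuous_real, rule hc) (use that in auto)
  have refl: "h (k / u) = h u" if "u > 0" for u
  proof -
    have "t\<^sup>2 / (4 * (k / u)\<^sup>2) = w\<^sup>2 * u\<^sup>2" "w\<^sup>2 * (k / u)\<^sup>2 = t\<^sup>2 / (4 * u\<^sup>2)"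
      using t w that by (auto simp: k power_divide power_mult_distrib field_simps)
    then show ?thesis by (simp add: h_def add.commute)
  qed
  \<comment> \<open>The reflection exchanges \<open>{k / n..s}\<close> and \<open>{s..n}\<close>, so
    with these cutoffs the identity is exact for finite \<open>n\<close>. The map is decreasing,
    hence the sign; the second of the two oriented integrals is the one that survives.\<close>
  have "((\<lambda>u. (- k / u\<^sup>2) *\<^sub>R h (k / u)) has_integral (integral {k / s..k / n} h - integral {k / n..k / s} h)) {s..n}"
  proof (rule has_integral_substitution_general[of "{}" s n "\<lambda>u. k / u" "k / n" s])
    show "(\<lambda>u. k / u) ` {s..n} \<subseteq> {k / n..s}"
    proof clarsimp
      fix u assume u: "s \<le> u" "u \<le> n"
      have "k / u \<le> k / s" using u s k0 by (intro divide_left_mono) auto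
      moreover have "k / s = s" using s by (simp add: field_simps)
      moreover have "k / n \<le> k / u" using u s k0 n by (intro divide_left_mono) auto
      ultimately show "k / n \<le> k / u \<and> k / u \<le> s" by simp
    qed
    show "continuous_on {k / n..s} h" by (rule hc) (use kn0 in auto)
    show "continuous_on {s..n} (\<lambda>u. k / u)" using s by (intro continuous_intros) auto
    show "((\<lambda>u. k / u) has_real_derivative - k / u\<^sup>2) (at u within {s..n})" if "u \<in> {s..n} - {}" for u
      using that s by (auto intro!: derivative_eq_intros simp: power2_eq_square)
  qed (use sn in auto)
  moreover have "k / s = s" using s by (simp add: field_simps)
  moreover have "integral {s..k / n} h = 0"
    using kn by (cases "k / n = s") auto
  ultimately have "((\<lambda>u. (- k / u\<^sup>2) *\<^sub>R h (k / u)) has_integral - integral {k / n..s} h) {s..n}"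
    by simp
  from has_integral_neg[OF this] have "((\<lambda>u. (k / u\<^sup>2) *\<^sub>R h (k / u)) has_integral integral {k / n..s} h) {s..n}"
    by simp
  moreover have "(k / u\<^sup>2) *\<^sub>R h (k / u) = (k / u\<^sup>2) *\<^sub>R h u" if "u \<in> {s..n}" for u
    using refl[of u] that s by simp
  ultimately have "((\<lambda>u. (k / u\<^sup>2) *\<^sub>R h u) has_integral integral {k / n..s} h) {s..n}"
    by (rule has_integral_eq[rotated])
  then have "((\<lambda>u. (k / u\<^sup>2) *\<^sub>R h u + h u) has_integral (integral {k / n..s} h + integral {s..n} h)) {s..n}"
    by (intro has_integral_add integrable_integral hint s)
  also have "integral {k / n..s} h + integral {s..n} h = integral {k / n..n} h"
    by (rule Henstock_Kurzweil_Integration.integral_combine[OF kn sn hint[OF kn0]])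
  finally have A: "((\<lambda>u. (k / u\<^sup>2) *\<^sub>R h u + h u) has_integral integral {k / n..n} h) {s..n}" .
  define v where "v u = w * u - t / (2 * u)" for u
  have vs: "v s = 0"
  proof -
    have "w * (s * s) = t / 2" unfolding s(2) k using w by simp
    then have "w * s = t / (2 * s)" using s(1) by (simp add: field_simps)
    then show ?thesis by (simp add: v_def)
  qed
  have v': "(v has_real_derivative w + t / (2 * u\<^sup>2)) (at u within S)" if "u > 0" for u S
    unfolding v_def[abs_def] using that by (auto intro!: derivative_eq_intros simp: power2_eq_square)
  have vmono: "v a \<le> v b" if "s \<le> a" "a \<le> b" for a b
  proof -
    have "w * a \<le> w * b" using w that by simp
    moreover have "t / (2 * b) \<le> t / (2 * a)" using t s that by (intro divide_left_mono) auto
    ultimately show ?thesis by (simp add: v_def)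
  qed
  have "((\<lambda>u. (w + t / (2 * u\<^sup>2)) *\<^sub>R cis ((v u)\<^sup>2)) has_integral integral {v s..v n} (\<lambda>v. cis (v\<^sup>2))) {s..n}"
  proof (rule has_integral_substitution[of s n v "v s" "v n"])
    show "v ` {s..n} \<subseteq> {v s..v n}" using vmono by auto
  qed (use sn vmono s v' in \<open>auto intro!: continuous_intros\<close>)
  then have "((\<lambda>u. (cis (t * w) / of_real w) * ((w + t / (2 * u\<^sup>2)) *\<^sub>R cis ((v u)\<^sup>2))) has_integral
       (cis (t * w) / of_real w) * fresnel (v n)) {s..n}"
    unfolding vs fresnel_def by (rule has_integral_mult_right)
  moreover have "(cis (t * w) / of_real w) * ((w + t / (2 * u\<^sup>2)) *\<^sub>R cis ((v u)\<^sup>2)) = (k / u\<^sup>2) *\<^sub>R h u + h u" if "u \<in> {s..n}" for u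
  proof -
    have u: "u > 0" using that s by simp
    have "t * w + (v u)\<^sup>2 = t\<^sup>2 / (4 * u\<^sup>2) + w\<^sup>2 * u\<^sup>2"
      using u by (simp add: v_def power2_eq_square field_simps)
    then have hu: "h u = cis (t * w) * cis ((v u)\<^sup>2)" unfolding h_def cis_mult by simp
    have "(w + t / (2 * u\<^sup>2)) / w = 1 + k / u\<^sup>2" using w u by (simp add: k field_simps)
    then have *: "complex_of_real (w + t / (2 * u\<^sup>2)) / of_real w = 1 + of_real (k / u\<^sup>2)"
      by (metis of_real_1 of_real_add of_real_divide)
    have "(cis (t * w) / of_real w) * ((w + t / (2 * u\<^sup>2)) *\<^sub>R cis ((v u)\<^sup>2)) =
      complex_of_real (w + t / (2 * u\<^sup>2)) / of_real w * h u"
      unfolding hu scaleR_conv_of_real by (simp only: times_divide_eq_left times_divide_eq_right mult_ac)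
    then show ?thesis unfolding * scaleR_conv_of_real by (simp only: distrib_right mult_1 add.commute)
  qed
  ultimately have "((\<lambda>u. (k / u\<^sup>2) *\<^sub>R h u + h u) has_integral (cis (t * w) / of_real w) * fresnel (v n)) {s..n}"
    by (rule has_integral_eq[rotated])
  with A have "integral {k / n..n} h = (cis (t * w) / of_real w) * fresnel (v n)"
    by (rule has_integral_unique)
  then show ?thesis by (simp add: h_def[abs_def] v_def)
qed

text \<open>The natural lower cutoff \<open>k / n\<close> depends on \<open>w\<close>, hence on the
  frequency. Here both cutoffs are independent of it, as the exchange of integrals requires.\<close>

definition wave_kernel :: "real \<Rightarrow> nat \<Rightarrow> real \<Rightarrow> complex"
  where "wave_kernel t i w = integral {1 / real (Suc i)..real (Suc i)} (\<lambda>u. cis (t\<^sup>2 / (4 * u\<^sup>2) + w\<^sup>2 * u\<^sup>2))"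

text \<open>The majorant for dominated convergence: it may depend on \<open>t\<close> but not on
  \<open>i\<close>. Below 1 the integrand is bounded trivially; above 1 one integration by parts
  gains \<open>1 / w\<^sup>2\<close>, which is integrable over the five-dimensional torus.\<close>

lemma norm_wave_kernel_le:
  assumes w: "w \<noteq> 0"
  shows "norm (wave_kernel t i w) \<le> 1 + (t\<^sup>2 / 4 + 2) / w\<^sup>2"
proof -
  define n where "n = real (Suc i)"
  define h where "h u = cis (t\<^sup>2 / (4 * u\<^sup>2) + w\<^sup>2 * u\<^sup>2)" for u
  have n: "n \<ge> 1" by (simp add: n_def)
  have hc: "continuous_on S h" if "S \<subseteq> {0<..}" for S
    unfolding h_def using that by (intro continuous_intros) auto
  have hint: "h integrable_on {a..b}" if "a > 0" for a b
    by (rule integrable_continuous_real, rule hc) (use that in auto)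
  have w2: "w\<^sup>2 > 0" using w by simp
  have "norm (integral {1 / n..1} h) \<le> 1 * (1 - 1 / n)"
  proof (rule integral_bound)
    show "continuous_on {1 / n..1} h"
      by (rule hc) (use n in \<open>auto intro: less_le_trans[of 0 "1 / n"]\<close>)
  qed (use n in \<open>auto simp: h_def\<close>)
  also have "\<dots> \<le> 1" using n by simp
  finally have I1: "norm (integral {1 / n..1} h) \<le> 1" .
  \<comment> \<open>Dividing by the derivative \<open>2 * w\<^sup>2 * u\<close> of the second phase
    term alone avoids the zero of the full phase derivative; the other term goes into the error
    \<open>R\<close>.\<close>
  define P where "P u = of_real (1 / (2 * w\<^sup>2 * u)) * (- \<i> * h u)" for u
  define D where "D u = - ((t\<^sup>2 / 4 + 1) / w\<^sup>2 / u)" for u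
  have "norm (integral {1..n} h) \<le> norm (P 1) + norm (P n) + (D n - D 1)"
  proof (rule norm_integral_by_parts[OF n])
    show "continuous_on {1..n} h" by (rule hc) auto
    fix u assume u: "u \<in> {1..n}"
    then have u1: "u \<ge> 1" by simp
    define R where "R u = of_real (1 / (2 * w\<^sup>2 * u)) * (- of_real (t\<^sup>2 / (2 * u ^ 3)) * h u) + of_real (- 1 / (2 * w\<^sup>2 * u\<^sup>2)) * (- \<i> * h u)" for u
    have h': "(h has_vector_derivative \<i> * of_real (2 * w\<^sup>2 * u - t\<^sup>2 / (2 * u ^ 3)) * h u) (at u within {1..n})"
      unfolding h_def[abs_def]
      by (rule has_vector_derivative_cis)
        (use u1 in \<open>auto intro!: derivative_eq_intros simp: power2_eq_square power3_eq_cube field_simps\<close>)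
    have q': "((\<lambda>u. of_real (1 / (2 * w\<^sup>2 * u)) :: complex) has_vector_derivative of_real (- 1 / (2 * w\<^sup>2 * u\<^sup>2))) (at u within {1..n})"
      by (intro has_vector_derivative_of_real)
        (use u1 w in \<open>auto intro!: derivative_eq_intros simp: power2_eq_square field_simps\<close>)
    have "(P has_vector_derivative of_real (1 / (2 * w\<^sup>2 * u)) * (- \<i> * (\<i> * of_real (2 * w\<^sup>2 * u - t\<^sup>2 / (2 * u ^ 3)) * h u)) +
       of_real (- 1 / (2 * w\<^sup>2 * u\<^sup>2)) * (- \<i> * h u)) (at u within {1..n})"
      unfolding P_def[abs_def]
      by (intro has_vector_derivative_mult_right has_vector_derivative_mult h' q')
    also have "of_real (1 / (2 * w\<^sup>2 * u)) * (- \<i> * (\<i> * of_real (2 * w\<^sup>2 * u - t\<^sup>2 / (2 * u ^ 3)) * h u)) +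
       of_real (- 1 / (2 * w\<^sup>2 * u\<^sup>2)) * (- \<i> * h u) = h u + R u"
    proof -
      have 1: "- \<i> * (\<i> * of_real (2 * w\<^sup>2 * u - t\<^sup>2 / (2 * u ^ 3)) * h u) = of_real (2 * w\<^sup>2 * u) * h u - of_real (t\<^sup>2 / (2 * u ^ 3)) * h u"
        unfolding of_real_diff left_diff_distrib[symmetric] by (simp add: mult.assoc[symmetric])
      have 2: "complex_of_real (1 / (2 * w\<^sup>2 * u)) * of_real (2 * w\<^sup>2 * u) = 1"
        unfolding of_real_mult[symmetric] using u1 w by simp
      have "of_real (1 / (2 * w\<^sup>2 * u)) * (of_real (2 * w\<^sup>2 * u) * h u) = h u"
        unfolding mult.assoc[symmetric] 2 by simp
      then show ?thesis unfolding 1 R_def right_diff_distrib by (simp only: mult_minus_left mult_minus_right diff_conv_add_uminus add.assoc)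
    qed
    finally show "(P has_vector_derivative h u + R u) (at u within {1..n})" .
    show "(D has_vector_derivative (t\<^sup>2 / 4 + 1) / w\<^sup>2 / u\<^sup>2) (at u within {1..n})"
      unfolding D_def[abs_def] has_real_derivative_iff_has_vector_derivative[symmetric]
      using u1 w by (auto intro!: derivative_eq_intros simp: power2_eq_square field_simps)
    have "norm (R u) \<le> norm (of_real (1 / (2 * w\<^sup>2 * u)) * (- of_real (t\<^sup>2 / (2 * u ^ 3)) * h u)) + norm (of_real (- 1 / (2 * w\<^sup>2 * u\<^sup>2)) * (- \<i> * h u))"
      unfolding R_def by (rule norm_triangle_ineq)
    also have "\<dots> = 1 / (2 * w\<^sup>2 * u) * (t\<^sup>2 / (2 * u ^ 3)) + 1 / (2 * w\<^sup>2 * u\<^sup>2)"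
      using u1 by (simp add: norm_mult norm_divide norm_power h_def)
    also have "\<dots> \<le> (t\<^sup>2 / 4) / w\<^sup>2 / u\<^sup>2 + 1 / w\<^sup>2 / u\<^sup>2"
    proof (rule add_mono)
      have "u\<^sup>2 \<le> u * u ^ 3" using u1 power_increasing[of 2 4 u] by (simp add: power3_eq_cube power4_eq_xxxx)
      then have "t\<^sup>2 / (4 * w\<^sup>2 * (u * u ^ 3)) \<le> t\<^sup>2 / (4 * w\<^sup>2 * u\<^sup>2)"
        using w2 u1 by (intro divide_left_mono mult_left_mono mult_pos_pos) auto
      then show "1 / (2 * w\<^sup>2 * u) * (t\<^sup>2 / (2 * u ^ 3)) \<le> (t\<^sup>2 / 4) / w\<^sup>2 / u\<^sup>2"
        by (simp add: mult_ac)
      show "1 / (2 * w\<^sup>2 * u\<^sup>2) \<le> 1 / w\<^sup>2 / u\<^sup>2"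
        using w2 u1 by (simp add: field_simps)
    qed
    also have "\<dots> = (t\<^sup>2 / 4 + 1) / w\<^sup>2 / u\<^sup>2" by (simp add: add_divide_distrib)
    finally show "norm (R u) \<le> (t\<^sup>2 / 4 + 1) / w\<^sup>2 / u\<^sup>2" .
  qed
  also have "\<dots> \<le> (t\<^sup>2 / 4 + 2) / w\<^sup>2"
  proof -
    have "norm (P 1) = 1 / (2 * w\<^sup>2)" by (simp add: P_def norm_mult norm_divide norm_power h_def)
    moreover have "norm (P n) \<le> 1 / (2 * w\<^sup>2)"
    proof -
      have "norm (P n) = 1 / (2 * w\<^sup>2 * n)" using n by (simp add: P_def norm_mult norm_divide norm_power h_def)
      also have "\<dots> \<le> 1 / (2 * w\<^sup>2 * 1)" using n w2 by (intro divide_left_mono mult_left_mono mult_pos_pos) auto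
      finally show ?thesis by simp
    qed
    moreover have "D n \<le> 0"
    proof -
      have "0 \<le> (t\<^sup>2 / 4 + 1) / w\<^sup>2 / n" using n by (intro divide_nonneg_nonneg add_nonneg_nonneg) auto
      then show ?thesis by (simp only: D_def neg_le_0_iff_le)
    qed
    moreover have "- D 1 = (t\<^sup>2 / 4 + 1) / w\<^sup>2" by (simp add: D_def)
    moreover have "1 / (2 * w\<^sup>2) + 1 / (2 * w\<^sup>2) + (t\<^sup>2 / 4 + 1) / w\<^sup>2 = (t\<^sup>2 / 4 + 2) / w\<^sup>2"
      using w2 by (simp add: field_simps)
    ultimately show ?thesis by linarith
  qed
  finally have I2: "norm (integral {1..n} h) \<le> (t\<^sup>2 / 4 + 2) / w\<^sup>2" .
  have "integral {1 / n..n} h = integral {1 / n..1} h + integral {1..n} h"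
    using n hint[of "1 / n" n] by (simp add: Henstock_Kurzweil_Integration.integral_combine)
  then have "norm (integral {1 / n..n} h) \<le> 1 + (t\<^sup>2 / 4 + 2) / w\<^sup>2"
    using I1 I2 by (smt (verit) norm_triangle_ineq)
  then show ?thesis by (simp add: wave_kernel_def h_def[abs_def] n_def)
qed

text \<open>The lower cutoffs \<open>1 / n\<close> and \<open>k / n\<close> differ by
  \<open>\<bar>k - 1\<bar> / n\<close> and the integrand has modulus one, so the limit is that of
  the exact formula with cutoff \<open>k / n\<close>.\<close>

lemma wave_kernel_tendsto:
  assumes t: "t > 0" and w: "w > 0" and L: "(fresnel \<longlongrightarrow> L) at_top"
  shows "(\<lambda>i. wave_kernel t i w) \<longlonglongrightarrow> cis (t * w) / of_real w * L"
proof -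
  define k where "k = t / (2 * w)"
  have k0: "k > 0" using t w by (simp add: k_def)
  define h where "h u = cis (t\<^sup>2 / (4 * u\<^sup>2) + w\<^sup>2 * u\<^sup>2)" for u
  have hc: "continuous_on S h" if "S \<subseteq> {0<..}" for S
    unfolding h_def using that by (intro continuous_intros) auto
  have hint: "h integrable_on {a..b}" if "a > 0" for a b
    by (rule integrable_continuous_real, rule hc) (use that in auto)
  define G where "G i = integral {k / real (Suc i)..real (Suc i)} h" for i
  have ev: "eventually (\<lambda>i. k \<le> (real (Suc i))\<^sup>2) sequentially"
    by real_asymp
  have "(\<lambda>i. cis (t * w) / of_real w * fresnel (w * real (Suc i) - t / (2 * real (Suc i)))) \<longlonglongrightarrow> cis (t * w) / of_real w * L"
  proof (intro tendsto_intros filterlim_compose[OF L])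
    show "filterlim (\<lambda>i. w * real (Suc i) - t / (2 * real (Suc i))) at_top sequentially"
      using w by real_asymp
  qed
  then have G: "G \<longlonglongrightarrow> cis (t * w) / of_real w * L"
  proof (rule Lim_transform_eventually)
    show "eventually (\<lambda>i. cis (t * w) / of_real w * fresnel (w * real (Suc i) - t / (2 * real (Suc i))) = G i) sequentially"
      using ev
    proof eventually_elim
      case (elim i)
      show ?case unfolding G_def h_def
        by (rule Glasser_fresnel[symmetric, OF t w k_def _ elim]) simp
    qed
  qed
  have "(\<lambda>i. wave_kernel t i w - G i) \<longlonglongrightarrow> 0"
  proof (rule Lim_null_comparison)
    show "eventually (\<lambda>i. norm (wave_kernel t i w - G i) \<le> \<bar>k - 1\<bar> / real (Suc i)) sequentially"
      using ev
    proof eventually_elim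
      case (elim i)
      define n where "n = real (Suc i)"
      have n: "n \<ge> 1" by (simp add: n_def)
      have "1 * 1 \<le> n * n" using n by (intro mult_mono) auto
      then have nn: "k / n \<le> n" "1 / n \<le> n"
        using elim[folded n_def] n by (simp_all add: divide_le_eq power2_eq_square)
      have bd: "norm (integral {a..b} h) \<le> b - a" if "0 < a" "a \<le> b" for a b
      proof -
        have "norm (integral {a..b} h) \<le> 1 * (b - a)"
        proof (rule integral_bound)
          show "continuous_on {a..b} h" by (rule hc) (use that in auto)
        qed (use that in \<open>auto simp: h_def\<close>)
        then show ?thesis by simp
      qed
      have sp: "integral {a..n} h - integral {b..n} h = integral {a..b} h" if "0 < a" "a \<le> b" "b \<le> n" for a b
        using Henstock_Kurzweil_Integration.integral_combine[OF that(2,3) hint[OF that(1)]] by (simp add: algebra_simps)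
      have "norm (integral {1 / n..n} h - integral {k / n..n} h) \<le> \<bar>k - 1\<bar> / n"
      proof (cases "1 \<le> k")
        case True
        then have "1 / n \<le> k / n" using n by (simp add: divide_right_mono)
        then show ?thesis using sp[of "1 / n" "k / n"] bd[of "1 / n" "k / n"] n nn True by (simp add: diff_divide_distrib)
      next
        case False
        then have "k / n \<le> 1 / n" using n by (simp add: divide_right_mono)
        then show ?thesis using sp[of "k / n" "1 / n"] bd[of "k / n" "1 / n"] n nn False k0
          by (simp add: diff_divide_distrib norm_minus_commute[of "integral {1 / n..n} h"])
      qed
      then show ?case by (simp add: wave_kernel_def G_def h_def[abs_def] n_def)
    qed
    show "(\<lambda>i. \<bar>k - 1\<bar> / real (Suc i)) \<longlonglongrightarrow> 0"
      by real_asymp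
  qed
  from tendsto_add[OF this G] show ?thesis by simp
qed

section \<open>Integration over the torus\<close>

lemma torus_eq_cbox: "torus = cbox (\<chi> j. - pi) (\<chi> j. pi)"
  by (auto simp: torus_def mem_box_cart)

lemma prod_Basis_cart: "(\<Prod>b\<in>(Basis :: (real ^ 'n) set). g (axis_index b) (\<xi> \<bullet> b)) = (\<Prod>j\<in>UNIV. g j (\<xi> $ j))"
proof -
  have B: "(Basis :: (real ^ 'n) set) = (\<lambda>j. axis j 1) ` UNIV"
    by (auto simp: Basis_vec_def)
  have inj: "inj (\<lambda>j. axis j (1 :: real) :: real ^ 'n)"
    by (auto simp: inj_on_def axis_eq_axis)
  show ?thesis unfolding B
    by (subst prod.reindex[OF inj]) (simp add: inner_axis)
qed

lemma integral_lborel_cart_prod: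
  fixes f :: "'n::finite \<Rightarrow> real \<Rightarrow> 'b::{real_normed_field,banach,second_countable_topology}"
  assumes f: "\<And>j. integrable lborel (f j)"
  shows "integrable lborel (\<lambda>\<xi> :: real ^ 'n. \<Prod>j\<in>UNIV. f j (\<xi> $ j))"
    and "(LINT \<xi>|lborel. (\<Prod>j\<in>UNIV. f j ((\<xi> :: real ^ 'n) $ j))) = (\<Prod>j\<in>UNIV. LINT \<xi>|lborel. f j \<xi>)"
proof -
  interpret product_sigma_finite "\<lambda>_ :: real ^ 'n. lborel :: real measure" ..
  define M where "M = (\<Pi>\<^sub>M b\<in>(Basis :: (real ^ 'n) set). (lborel :: real measure))"
  define T where "T = (\<lambda>x :: real ^ 'n \<Rightarrow> real. \<Sum>b\<in>Basis. x b *\<^sub>R b)"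
  define F where "F \<xi> = (\<Prod>b\<in>Basis. f (axis_index b) (\<xi> \<bullet> b))" for \<xi> :: "real ^ 'n"
  have eq: "lborel = distr M borel T"
    unfolding M_def T_def by (rule lborel_eq)
  have fm [measurable]: "f j \<in> borel_measurable borel" for j
    using f[of j] by (simp add: integrable_iff_bounded)
  have T: "T \<in> M \<rightarrow>\<^sub>M borel" unfolding T_def M_def by measurable
  have F: "F \<in> borel_measurable borel" unfolding F_def by measurable
  have FT: "F (T x) = (\<Prod>b\<in>Basis. f (axis_index b) (x b))" for x
    unfolding F_def T_def by (intro prod.cong refl) (simp add: inner_sum_left_Basis)
  have "integrable M (\<lambda>x. F (T x))"
    unfolding FT M_def by (rule product_integrable_prod) (use f in auto)
  then have "integrable lborel F" using integrable_distr_eq[OF T F] eq by simp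
  then show "integrable lborel (\<lambda>\<xi> :: real ^ 'n. \<Prod>j\<in>UNIV. f j (\<xi> $ j))"
    by (simp add: F_def[abs_def] prod_Basis_cart)
  have "(LINT \<xi>|lborel. F \<xi>) = (LINT x|M. F (T x))"
    unfolding eq by (rule integral_distr[OF T F])
  also have "\<dots> = (\<Prod>b\<in>(Basis :: (real ^ 'n) set). LINT \<xi>|lborel. f (axis_index b) \<xi>)"
    unfolding FT M_def by (rule product_integral_prod) (use f in auto)
  also have "\<dots> = (\<Prod>j\<in>UNIV. LINT \<xi>|lborel. f j \<xi>)"
    using prod_Basis_cart[of "\<lambda>j _. LINT \<xi>|lborel. f j \<xi>" 0] by simp
  finally show "(LINT \<xi>|lborel. (\<Prod>j\<in>UNIV. f j ((\<xi> :: real ^ 'n) $ j))) = (\<Prod>j\<in>UNIV. LINT \<xi>|lborel. f j \<xi>)"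
    by (simp add: F_def prod_Basis_cart)
qed

text \<open>The indicator of the torus is itself a product over the coordinates. The codomain is
  kept general to serve both the complex exponentials and the real majorant.\<close>

lemma integral_torus_prod:
  fixes f :: "'n::finite \<Rightarrow> real \<Rightarrow> 'b::{real_normed_field,euclidean_space}"
  assumes f: "\<And>j. set_integrable lborel {-pi..pi} (f j)"
  shows "(\<lambda>\<xi> :: real ^ 'n. \<Prod>j\<in>UNIV. f j (\<xi> $ j)) integrable_on torus"
    and "integral torus (\<lambda>\<xi> :: real ^ 'n. \<Prod>j\<in>UNIV. f j (\<xi> $ j)) = (\<Prod>j\<in>UNIV. integral {-pi..pi} (f j))"
proof -
  let ?g = "\<lambda>j x. indicator {-pi..pi} x *\<^sub>R f j x"
  have g: "integrable lborel (?g j)" for j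
    using f[of j] by (simp add: set_integrable_def)
  have *: "(\<Prod>j\<in>UNIV. ?g j (\<xi> $ j)) = indicator torus \<xi> *\<^sub>R (\<Prod>j\<in>UNIV. f j (\<xi> $ j))" for \<xi> :: "real ^ 'n"
  proof (cases "\<xi> \<in> torus")
    case True
    then have "\<xi> $ j \<in> {-pi..pi}" for j by (simp add: torus_def)
    then have "?g j (\<xi> $ j) = f j (\<xi> $ j)" for j by (metis indicator_simps(1) scaleR_one)
    then show ?thesis using True by simp
  next
    case False
    then obtain j where "\<xi> $ j \<notin> {-pi..pi}" by (auto simp: torus_def)
    then have "?g j (\<xi> $ j) = 0" by (simp add: indicator_def del: atLeastAtMost_iff)
    then have "(\<Prod>j\<in>UNIV. ?g j (\<xi> $ j)) = 0" by (intro prod_zero) auto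
    then show ?thesis using False by simp
  qed
  have I: "set_integrable lborel torus (\<lambda>\<xi> :: real ^ 'n. \<Prod>j\<in>UNIV. f j (\<xi> $ j))"
    using integral_lborel_cart_prod(1)[of ?g, OF g] by (simp only: set_integrable_def *)
  show "(\<lambda>\<xi> :: real ^ 'n. \<Prod>j\<in>UNIV. f j (\<xi> $ j)) integrable_on torus"
    by (rule set_borel_integral_eq_integral(1)[OF I])
  have "integral torus (\<lambda>\<xi> :: real ^ 'n. \<Prod>j\<in>UNIV. f j (\<xi> $ j)) = (LINT \<xi>:torus|lborel. (\<Prod>j\<in>UNIV. f j ((\<xi> :: real ^ 'n) $ j)))"
    by (rule set_borel_integral_eq_integral(2)[OF I, symmetric])
  also have "\<dots> = (\<Prod>j\<in>UNIV. LINT \<xi>|lborel. ?g j \<xi>)"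
    using integral_lborel_cart_prod(2)[of ?g, OF g] by (simp only: set_lebesgue_integral_def *)
  also have "\<dots> = (\<Prod>j\<in>UNIV. integral {-pi..pi} (f j))"
    using set_borel_integral_eq_integral(2)[OF f] by (simp add: set_lebesgue_integral_def)
  finally show "integral torus (\<lambda>\<xi> :: real ^ 'n. \<Prod>j\<in>UNIV. f j (\<xi> $ j)) = (\<Prod>j\<in>UNIV. integral {-pi..pi} (f j))" .
qed

lemma set_integrable_abs_powr:
  assumes "a > -1" "c \<ge> 0"
  shows "set_integrable lborel {-c..c} (\<lambda>x::real. \<bar>x\<bar> powr a)"
proof -
  have 0: "(\<lambda>x. \<bar>x\<bar> powr a) integrable_on {0..c}"
    by (rule integrable_eq[OF integrable_on_powr_from_0[OF assms]]) auto
  then have 1: "(\<lambda>x. \<bar>x\<bar> powr a) integrable_on {-c..0}"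
    using Henstock_Kurzweil_Integration.integrable_reflect_real[where f = "\<lambda>x. \<bar>x\<bar> powr a" and a = 0 and b = c] by simp
  have "(\<lambda>x. \<bar>x\<bar> powr a) integrable_on {-c..c}"
    by (rule Henstock_Kurzweil_Integration.integrable_combine[OF _ _ 1 0]) (use assms in auto)
  then have "(\<lambda>x. \<bar>x\<bar> powr a) absolutely_integrable_on {-c..c}"
    by (rule nonnegative_absolutely_integrable_1) auto
  then show ?thesis
    unfolding set_integrable_def by (subst (asm) integrable_completion) auto
qed

section \<open>Size of the symbol near the origin\<close>

lemma dispersion_square: "(dispersion \<xi>)\<^sup>2 = (\<Sum>j\<in>UNIV. 2 - 2 * cos (\<xi> $ j))"
  unfolding dispersion_def by (rule real_sqrt_pow2) (auto intro!: sum_nonneg)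

lemma dispersion_nonneg: "dispersion \<xi> \<ge> 0"
  unfolding dispersion_def by (auto intro!: sum_nonneg)

lemma continuous_on_dispersion: "continuous_on S dispersion"
  unfolding dispersion_def[abs_def] by (intro continuous_intros)

text \<open>A single summand \<open>2 - 2 * cos (\<xi> $ j)\<close> is the square of twice the sine
  of half the angle, to which Jordan's inequality applies; \<open>pi < 4\<close> gives the round
  constant.\<close>

lemma abs_component_le_dispersion:
  assumes "\<xi> \<in> torus"
  shows "\<bar>\<xi> $ j\<bar> \<le> 2 * dispersion \<xi>"
proof -
  have j: "\<bar>\<xi> $ j\<bar> \<le> pi" using assms by (auto simp: torus_def abs_le_iff minus_le_iff)
  define y where "y = \<bar>\<xi> $ j\<bar> / 2"
  have "2 / pi * y \<le> sin y"
    by (rule Jordan_sin_ge) (use j in \<open>auto simp: y_def\<close>)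
  moreover have "\<bar>\<xi> $ j\<bar> / 4 \<le> 2 / pi * y"
  proof -
    have "pi * \<bar>\<xi> $ j\<bar> \<le> 4 * \<bar>\<xi> $ j\<bar>" using pi_less_4 by (intro mult_right_mono) auto
    then show ?thesis by (simp add: y_def field_simps)
  qed
  ultimately have s: "\<bar>\<xi> $ j\<bar> / 4 \<le> sin y" by linarith
  have "cos (\<xi> $ j) = cos (2 * y)" by (simp add: y_def)
  then have "2 - 2 * cos (\<xi> $ j) = (2 * sin y)\<^sup>2"
    by (simp add: cos_double_sin power_mult_distrib)
  moreover have "(\<bar>\<xi> $ j\<bar> / 2)\<^sup>2 \<le> (2 * sin y)\<^sup>2"
    using s by (intro power_mono) auto
  moreover have "2 - 2 * cos (\<xi> $ j) \<le> (dispersion \<xi>)\<^sup>2"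
    unfolding dispersion_square by (rule member_le_sum) auto
  ultimately have "(\<bar>\<xi> $ j\<bar> / 2)\<^sup>2 \<le> (dispersion \<xi>)\<^sup>2" by linarith
  then have "\<bar>\<xi> $ j\<bar> / 2 \<le> dispersion \<xi>"
    by (rule power2_le_imp_le) (rule dispersion_nonneg)
  then show ?thesis by simp
qed

text \<open>Distributing the inverse square evenly over five coordinates makes it a product of
  one-dimensional powers with exponent above -1, integrable without polar coordinates. Coordinates
  must be nonzero, since \<open>0 powr a\<close> is 0 and would destroy the majorant.\<close>

lemma inverse_dispersion_square_le:
  fixes \<xi> :: "real ^ 5"
  assumes \<xi>: "\<xi> \<in> torus" and nz: "\<And>j. \<xi> $ j \<noteq> 0"
  shows "dispersion \<xi> > 0" "1 / (dispersion \<xi>)\<^sup>2 \<le> 4 * (\<Prod>j\<in>UNIV. \<bar>\<xi> $ j\<bar> powr (- (2/5)))"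
proof -
  let ?w = "dispersion \<xi>"
  have "\<bar>\<xi> $ 1\<bar> > 0" using nz by simp
  then show w: "?w > 0" using abs_component_le_dispersion[OF \<xi>, of 1] by linarith
  have "(\<Prod>j\<in>(UNIV :: 5 set). (2 * ?w) powr (- (2/5))) \<le> (\<Prod>j\<in>UNIV. \<bar>\<xi> $ j\<bar> powr (- (2/5)))"
    using nz by (intro prod_mono conjI powr_mono2' abs_component_le_dispersion \<xi>) auto
  also have "(\<Prod>j\<in>(UNIV :: 5 set). (2 * ?w) powr (- (2/5))) = ((2 * ?w) powr (- (2/5))) ^ 5" by simp
  also have "\<dots> = (2 * ?w) powr (- 2)" using w by (simp add: powr_power)
  also have "\<dots> = 1 / (2 * ?w)\<^sup>2" using w by (simp add: powr_minus_divide)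
  finally show "1 / ?w\<^sup>2 \<le> 4 * (\<Prod>j\<in>UNIV. \<bar>\<xi> $ j\<bar> powr (- (2/5)))"
    by (simp add: power_mult_distrib)
qed

lemma negligible_coordinate_hyperplanes: "negligible {\<xi> :: real ^ 'n. \<exists>j. \<xi> $ j = 0}"
proof -
  have "{\<xi> :: real ^ 'n. \<exists>j. \<xi> $ j = 0} = (\<Union>j\<in>UNIV. {\<xi>. \<xi> $ j = 0})" by auto
  then show ?thesis
    by (simp only:) (intro negligible_Union; auto simp: negligible_standard_hyperplane_cart)
qed

lemma cis_sum: "finite I \<Longrightarrow> cis (\<Sum>i\<in>I. f i) = (\<Prod>i\<in>I. cis (f i))"
  by (induction I rule: finite_induct) (auto simp: cis_mult[symmetric])

definition lattice_phase :: "int ^ 'n::finite \<Rightarrow> real ^ 'n \<Rightarrow> real"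
  where "lattice_phase x \<xi> = (\<Sum>j\<in>UNIV. of_int (x $ j) * \<xi> $ j)"

lemma continuous_on_lattice_phase: "continuous_on S (lattice_phase x)"
  unfolding lattice_phase_def[abs_def] by (intro continuous_intros)

lemma propagator_product_eq_integral_torus:
  fixes x :: "int ^ 'n::finite"
  shows "propagator_product (\<lambda>j. of_int (x $ j)) u =
    integral torus (\<lambda>\<xi>. cis (lattice_phase x \<xi> + u\<^sup>2 * (dispersion \<xi>)\<^sup>2))"
proof -
  let ?f = "\<lambda>j \<xi>. cis (of_int (x $ j) * \<xi> + u\<^sup>2 * (2 - 2 * cos \<xi>))"
  have "integral torus (\<lambda>\<xi> :: real ^ 'n. \<Prod>j\<in>UNIV. ?f j (\<xi> $ j)) = (\<Prod>j\<in>UNIV. integral {-pi..pi} (?f j))"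
    by (rule integral_torus_prod) (intro borel_integrable_atLeastAtMost' continuous_intros)
  also have "\<dots> = propagator_product (\<lambda>j. of_int (x $ j)) u"
    by (simp add: propagator_product_def lattice_propagator_def)
  also have "(\<lambda>\<xi> :: real ^ 'n. \<Prod>j\<in>UNIV. ?f j (\<xi> $ j)) = (\<lambda>\<xi>. cis (lattice_phase x \<xi> + u\<^sup>2 * (dispersion \<xi>)\<^sup>2))"
    by (simp add: cis_sum[symmetric] lattice_phase_def dispersion_square sum.distrib sum_distrib_left)
  finally show ?thesis ..
qed

definition half_wave :: "int ^ 'n::finite \<Rightarrow> real \<Rightarrow> complex"
  where "half_wave x t = integral torus (\<lambda>\<xi>. cis (lattice_phase x \<xi>) * (cis (t * dispersion \<xi>) / of_real (dispersion \<xi>)))"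

text \<open>On the truncated range the integrand is jointly continuous on a compact box, also at the
  zero of the dispersion, so the order of integration can be exchanged.\<close>

lemma integral_torus_wave_kernel:
  fixes x :: "int ^ 'n::finite"
  shows "(\<lambda>\<xi>. cis (lattice_phase x \<xi>) * wave_kernel t i (dispersion \<xi>)) integrable_on torus"
    and "integral torus (\<lambda>\<xi>. cis (lattice_phase x \<xi>) * wave_kernel t i (dispersion \<xi>)) =
      integral {1 / real (Suc i)..real (Suc i)} (\<lambda>u. cis (t\<^sup>2 / (4 * u\<^sup>2)) * propagator_product (\<lambda>j. of_int (x $ j)) u)"
proof -
  define n where "n = real (Suc i)"
  define A B :: "real ^ 'n" where "A = (\<chi> j. - pi)" and "B = (\<chi> j. pi)"
  define f where "f u \<xi> = cis (t\<^sup>2 / (4 * u\<^sup>2) + (lattice_phase x \<xi> + u\<^sup>2 * (dispersion \<xi>)\<^sup>2))" for u \<xi>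
  have n: "n > 0" by (simp add: n_def)
  have u0: "u \<noteq> 0" if "1 / n \<le> u" for u using that n by (metis less_le_trans less_numeral_extra(3) zero_less_divide_1_iff)
  have cont: "continuous_on (cbox (1 / n, A) (n, B)) (\<lambda>(u, \<xi>). f u \<xi>)"
  proof -
    have "continuous_on (cbox (1 / n, A) (n, B)) (\<lambda>p. cis (t\<^sup>2 / (4 * (fst p)\<^sup>2) + (lattice_phase x (snd p) + (fst p)\<^sup>2 * (dispersion (snd p))\<^sup>2)))"
      by (intro continuous_intros continuous_on_compose2[OF continuous_on_lattice_phase] continuous_on_compose2[OF continuous_on_dispersion] subset_UNIV)
        (use u0 in auto)
    then show ?thesis by (simp add: f_def split_beta)
  qed
  have inner: "integral (cbox (1 / n) n) (\<lambda>u. f u \<xi>) = cis (lattice_phase x \<xi>) * wave_kernel t i (dispersion \<xi>)" for \<xi>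
  proof -
    have "f u \<xi> = cis (lattice_phase x \<xi>) * cis (t\<^sup>2 / (4 * u\<^sup>2) + (dispersion \<xi>)\<^sup>2 * u\<^sup>2)" for u
      unfolding f_def cis_mult by (simp add: algebra_simps)
    then have "integral {1 / n..n} (\<lambda>u. f u \<xi>) = integral {1 / n..n} (\<lambda>u. cis (lattice_phase x \<xi>) * cis (t\<^sup>2 / (4 * u\<^sup>2) + (dispersion \<xi>)\<^sup>2 * u\<^sup>2))"
      by (intro integral_cong)
    also have "\<dots> = cis (lattice_phase x \<xi>) * wave_kernel t i (dispersion \<xi>)"
      unfolding wave_kernel_def n_def by (rule integral_mult_right)
    finally show ?thesis by simp
  qed
  have outer: "integral (cbox A B) (f u) = cis (t\<^sup>2 / (4 * u\<^sup>2)) * propagator_product (\<lambda>j. of_int (x $ j)) u" for u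
  proof -
    have "integral torus (f u) = integral torus (\<lambda>\<xi>. cis (t\<^sup>2 / (4 * u\<^sup>2)) * cis (lattice_phase x \<xi> + u\<^sup>2 * (dispersion \<xi>)\<^sup>2))"
      unfolding f_def by (intro integral_cong) (simp only: cis_mult)
    also have "\<dots> = cis (t\<^sup>2 / (4 * u\<^sup>2)) * propagator_product (\<lambda>j. of_int (x $ j)) u"
      unfolding propagator_product_eq_integral_torus by (rule integral_mult_right)
    finally show ?thesis by (simp add: torus_eq_cbox A_def B_def)
  qed
  have "integral (cbox (1 / n) n) (\<lambda>u. integral (cbox A B) (f u)) = integral (cbox A B) (\<lambda>\<xi>. integral (cbox (1 / n) n) (\<lambda>u. f u \<xi>))"
    by (rule integral_swap_continuous[OF cont])
  then show "integral torus (\<lambda>\<xi>. cis (lattice_phase x \<xi>) * wave_kernel t i (dispersion \<xi>)) =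
      integral {1 / real (Suc i)..real (Suc i)} (\<lambda>u. cis (t\<^sup>2 / (4 * u\<^sup>2)) * propagator_product (\<lambda>j. of_int (x $ j)) u)"
    unfolding inner outer by (simp add: torus_eq_cbox A_def B_def n_def)
  have "continuous_on (cbox A B) (\<lambda>\<xi>. integral (cbox (1 / n) n) (\<lambda>u. f u \<xi>))"
  proof (rule integral_continuous_on_param)
    have "continuous_on (cbox A B \<times> cbox (1 / n) n) (\<lambda>p. (\<lambda>(u, \<xi>). f u \<xi>) (snd p, fst p))"
      by (rule continuous_on_compose2[OF cont]) (auto intro!: continuous_intros simp: cbox_Pair_eq)
    then show "continuous_on (cbox A B \<times> cbox (1 / n) n) (\<lambda>(\<xi>, u). f u \<xi>)"
      by (simp add: split_beta)
  qed
  then show "(\<lambda>\<xi>. cis (lattice_phase x \<xi>) * wave_kernel t i (dispersion \<xi>)) integrable_on torus"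
    unfolding inner torus_eq_cbox A_def B_def by (rule integrable_continuous)
qed

text \<open>Dominated convergence away from the coordinate hyperplanes: this null set contains the
  zero of the dispersion and all points where the product majorant degenerates.\<close>

lemma half_wave_limit:
  fixes x :: "int ^ 5"
  assumes t: "t > 0" and L: "(fresnel \<longlongrightarrow> L) at_top" "L \<noteq> 0"
  shows "(\<lambda>\<xi>. cis (lattice_phase x \<xi>) * (cis (t * dispersion \<xi>) / of_real (dispersion \<xi>))) integrable_on torus"
    and "(\<lambda>i. integral torus (\<lambda>\<xi>. cis (lattice_phase x \<xi>) * wave_kernel t i (dispersion \<xi>))) \<longlonglongrightarrow> half_wave x t * L"
proof -
  define Z where "Z = {\<xi> :: real ^ 5. \<exists>j. \<xi> $ j = 0}"
  define f where "f i \<xi> = cis (lattice_phase x \<xi>) * wave_kernel t i (dispersion \<xi>)" for i \<xi>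
  define g where "g \<xi> = cis (lattice_phase x \<xi>) * (cis (t * dispersion \<xi>) / of_real (dispersion \<xi>))" for \<xi>
  define H where "H \<xi> = 1 + (t\<^sup>2 / 4 + 2) * (4 * (\<Prod>j\<in>UNIV. \<bar>\<xi> $ j\<bar> powr (- (2/5))))" for \<xi> :: "real ^ 5"
  have Z: "negligible Z" unfolding Z_def by (rule negligible_coordinate_hyperplanes)
  have neg: "negligible {\<xi> \<in> torus - (torus - Z). h \<xi> \<noteq> 0}" "negligible {\<xi> \<in> (torus - Z) - torus. h \<xi> \<noteq> 0}"
    for h :: "real ^ 5 \<Rightarrow> 'a::real_normed_vector"
    by (rule negligible_subset[OF Z]; auto)+
  have iff: "h integrable_on torus - Z \<longleftrightarrow> h integrable_on torus" for h :: "real ^ 5 \<Rightarrow> 'a::euclidean_space"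
    by (rule integrable_spike_set_eq) (rule negligible_subset[OF Z], auto)
  have ieq: "integral (torus - Z) h = integral torus h" for h :: "real ^ 5 \<Rightarrow> 'a::euclidean_space"
    by (rule integral_spike_set[OF neg(2) neg(1)])
  have fi: "f i integrable_on torus - Z" for i
    unfolding iff f_def by (rule integral_torus_wave_kernel)
  have Hi: "H integrable_on torus - Z"
  proof -
    have "(\<lambda>\<xi> :: real ^ 5. \<Prod>j\<in>UNIV. \<bar>\<xi> $ j\<bar> powr (- (2/5))) integrable_on torus"
      by (rule integral_torus_prod(1)) (rule set_integrable_abs_powr, auto)
    moreover have "(\<lambda>\<xi> :: real ^ 5. 1 :: real) integrable_on torus"
      unfolding torus_eq_cbox by (rule integrable_const)
    ultimately show ?thesis
      unfolding iff H_def by (intro integrable_add integrable_on_mult_right)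
  qed
  have pos: "dispersion \<xi> > 0" "1 / (dispersion \<xi>)\<^sup>2 \<le> 4 * (\<Prod>j\<in>UNIV. \<bar>\<xi> $ j\<bar> powr (- (2/5)))" if "\<xi> \<in> torus - Z" for \<xi>
    using inverse_dispersion_square_le[of \<xi>] that by (auto simp: Z_def)
  have le: "norm (f i \<xi>) \<le> H \<xi>" if \<xi>: "\<xi> \<in> torus - Z" for i \<xi>
  proof -
    have "norm (f i \<xi>) \<le> 1 + (t\<^sup>2 / 4 + 2) * (1 / (dispersion \<xi>)\<^sup>2)"
      using norm_wave_kernel_le[of "dispersion \<xi>" t i] pos[OF \<xi>] by (simp add: f_def norm_mult)
    also have "\<dots> \<le> H \<xi>"
      unfolding H_def using pos[OF \<xi>] by (intro add_left_mono mult_left_mono) auto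
    finally show ?thesis .
  qed
  have lim: "(\<lambda>i. f i \<xi>) \<longlonglongrightarrow> g \<xi> * L" if \<xi>: "\<xi> \<in> torus - Z" for \<xi>
    unfolding f_def g_def mult.assoc
    by (intro tendsto_intros wave_kernel_tendsto t pos \<xi> L)
  note dom = dominated_convergence[OF fi Hi le lim]
  have gL: "(\<lambda>\<xi>. g \<xi> * L) integrable_on torus" using dom(1) unfolding iff .
  \<comment> \<open>Integrability of the limit comes with the factor \<open>L\<close>; since
    \<open>L\<close> is nonzero it can be cancelled.\<close>
  have "(\<lambda>\<xi>. g \<xi> * L * inverse L) integrable_on torus"
    by (rule integrable_on_mult_left[OF gL])
  then show "g integrable_on torus" using L(2) by (simp add: g_def[abs_def] mult.assoc)
  have gI: "integral torus (\<lambda>\<xi>. g \<xi> * L) = half_wave x t * L"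
    unfolding half_wave_def g_def by (rule integral_mult_left)
  show "(\<lambda>i. integral torus (f i)) \<longlonglongrightarrow> half_wave x t * L"
    using dom(2) unfolding ieq gI by blast
qed

lemma half_wave_decay:
  "\<exists>K>0. \<forall>(x :: int ^ 5) t. t > 0 \<longrightarrow> norm (half_wave x t) \<le> K * t powr (- (11/6))"
proof -
  obtain L where L: "L \<noteq> 0" "(fresnel \<longlongrightarrow> L) at_top" using fresnel_limit by blast
  obtain C where C: "C > 0" and bound: "\<And>(m :: 5 \<Rightarrow> real) \<epsilon> T n. 0 < \<epsilon> \<Longrightarrow> \<epsilon> \<le> T \<Longrightarrow> T \<le> n \<Longrightarrow>
    norm (integral {\<epsilon>..n} (\<lambda>u. cis (T ^ 4 / (4 * u\<^sup>2)) * propagator_product m u)) \<le> C * T powr (- (11/3))"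
    using oscillatory_propagator_integral_bound by blast
  have "norm (half_wave x t) \<le> C / norm L * t powr (- (11/6))" if t: "t > 0" for x :: "int ^ 5" and t
  proof -
    define T where "T = sqrt t"
    have T: "T > 0" using t by (simp add: T_def)
    have T4: "T ^ 4 = t\<^sup>2" using t by (simp add: T_def power4_eq_xxxx power2_eq_square)
    have Tp: "T powr (- (11/3)) = t powr (- (11/6))"
    proof -
      have "T = t powr (1/2)" using t powr_half_sqrt[of t] by (simp add: T_def)
      then show ?thesis by (simp only: powr_powr) simp
    qed
    have "norm (half_wave x t * L) \<le> C * T powr (- (11/3))"
    proof (rule tendsto_upperbound[OF tendsto_norm[OF half_wave_limit(2)[OF t L(2,1), of x]]])
      \<comment> \<open>For fixed \<open>t\<close> the cutoffs eventually enclose \<open>T\<close>,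
        and the oscillatory bound does not depend on them, so it survives the limit.\<close>
      have "eventually (\<lambda>i. 1 / real (Suc i) \<le> T) sequentially" "eventually (\<lambda>i. T \<le> real (Suc i)) sequentially"
        using T by real_asymp+
      then show "eventually (\<lambda>i. norm (integral torus (\<lambda>\<xi>. cis (lattice_phase x \<xi>) * wave_kernel t i (dispersion \<xi>))) \<le> C * T powr (- (11/3))) sequentially"
      proof eventually_elim
        case (elim i)
        show ?case
          unfolding integral_torus_wave_kernel(2) T4[symmetric]
          by (rule bound) (use elim in auto)
      qed
    qed simp
    then have "norm (half_wave x t) * norm L \<le> C * t powr (- (11/6))" by (simp add: norm_mult Tp)
    then show ?thesis using L(1) by (simp add: field_simps)
  qed
  then show ?thesis using C L(1) by (intro exI[of _ "C / norm L"]) auto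
qed

section \<open>From the half-wave kernel to the fundamental solution\<close>

lemma sin_quotient_bounds: "\<bar>sin (t * w) / w\<bar> \<le> \<bar>t\<bar>" for t w :: real
proof (cases "w = 0")
  case False
  have "\<bar>sin (t * w)\<bar> \<le> \<bar>t * w\<bar>" by (rule abs_sin_x_le_abs_x)
  then show ?thesis using False by (simp add: abs_mult divide_le_eq)
qed simp

lemma fundamental_solution_eq:
  fixes x :: "int ^ 'n::finite"
  defines "g \<equiv> \<lambda>t \<xi>. cis (lattice_phase x \<xi>) * complex_of_real (sin (t * dispersion \<xi>) / dispersion \<xi>)"
  shows "g t integrable_on torus"
    and "fundamental_solution x t = 1 / (2 * of_real pi) ^ CARD('n) * integral torus (g t)"
proof -
  have "set_integrable lborel torus (g t)"
    unfolding set_integrable_def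
  proof (rule integrableI_bounded_set_indicator[where B = "\<bar>t\<bar>"])
    show "torus \<in> sets (lborel :: (real ^ 'n) measure)" by (simp add: torus_eq_cbox)
    have "(\<lambda>\<xi> :: real ^ 'n. cis (lattice_phase x \<xi>)) \<in> borel_measurable borel"
      by (intro borel_measurable_continuous_onI continuous_intros continuous_on_lattice_phase)
    moreover have "dispersion \<in> borel_measurable (borel :: (real ^ 'n) measure)"
      by (intro borel_measurable_continuous_onI continuous_on_dispersion)
    ultimately show "g t \<in> borel_measurable lborel"
      unfolding g_def by measurable
    show "emeasure lborel (torus :: (real ^ 'n) set) < \<infinity>"
      unfolding torus_eq_cbox by (rule emeasure_lborel_cbox_finite)
    show "AE \<xi> in lborel. \<xi> \<in> torus \<longrightarrow> norm (g t \<xi>) \<le> \<bar>t\<bar>"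
      using sin_quotient_bounds[of t] by (auto simp: g_def norm_mult norm_divide)
  qed
  note * = set_borel_integral_eq_integral[OF this]
  show "g t integrable_on torus" by (rule *(1))
  have "fundamental_solution x t = 1 / (2 * of_real pi) ^ CARD('n) * (LINT \<xi>:torus|lborel. g t \<xi>)"
    unfolding fundamental_solution_def g_def lattice_phase_def cis_conv_exp ..
  then show "fundamental_solution x t = 1 / (2 * of_real pi) ^ CARD('n) * integral torus (g t)"
    unfolding *(2) .
qed

lemma fundamental_solution_uminus: "fundamental_solution x (- t) = - fundamental_solution x t"
  unfolding fundamental_solution_eq(2) by (simp add: Henstock_Kurzweil_Integration.integral_neg)

text \<open>The sine is a difference of conjugate exponentials, but conjugating the kernel also
  reverses the lattice phase; evaluating at \<open>- x\<close> compensates.\<close>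

lemma fundamental_solution_eq_half_wave:
  fixes x :: "int ^ 5"
  assumes t: "t > 0"
  shows "fundamental_solution x t = 1 / (2 * of_real pi) ^ 5 * ((half_wave x t - cnj (half_wave (- x) t)) / (2 * \<i>))"
proof -
  obtain L where L: "(fresnel \<longlongrightarrow> L) at_top" "L \<noteq> 0" using fresnel_limit by blast
  define h where "h x \<xi> = cis (lattice_phase x \<xi>) * (cis (t * dispersion \<xi>) / of_real (dispersion \<xi>))" for x :: "int ^ 5" and \<xi>
  have hi: "h x integrable_on torus" for x
    unfolding h_def by (rule half_wave_limit(1)[OF t L])
  have eq: "cis (lattice_phase x \<xi>) * of_real (sin (t * dispersion \<xi>) / dispersion \<xi>) = (h x \<xi> - cnj (h (- x) \<xi>)) * inverse (2 * \<i>)" for \<xi>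
  proof -
    have 1: "lattice_phase (- x) \<xi> = - lattice_phase x \<xi>"
      by (simp add: lattice_phase_def sum_negf)
    have 2: "cis (t * dispersion \<xi>) - cnj (cis (t * dispersion \<xi>)) = of_real (sin (t * dispersion \<xi>)) * (2 * \<i>)"
      by (simp add: complex_eq_iff)
    have 3: "cnj (cis (- lattice_phase x \<xi>)) = cis (lattice_phase x \<xi>)" by (simp add: cis_cnj)
    have "h x \<xi> - cnj (h (- x) \<xi>) = cis (lattice_phase x \<xi>) * ((cis (t * dispersion \<xi>) - cnj (cis (t * dispersion \<xi>))) / of_real (dispersion \<xi>))"
      unfolding h_def 1 complex_cnj_mult complex_cnj_divide complex_cnj_complex_of_real 3 by (simp only: diff_divide_distrib right_diff_distrib)
    also have "\<dots> = cis (lattice_phase x \<xi>) * of_real (sin (t * dispersion \<xi>) / dispersion \<xi>) * (2 * \<i>)"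
      unfolding 2 by simp
    finally show ?thesis by simp
  qed
  have "fundamental_solution x t = 1 / (2 * of_real pi) ^ 5 * integral torus (\<lambda>\<xi>. (h x \<xi> - cnj (h (- x) \<xi>)) * inverse (2 * \<i>))"
    unfolding fundamental_solution_eq(2) eq by simp
  also have "integral torus (\<lambda>\<xi>. (h x \<xi> - cnj (h (- x) \<xi>)) * inverse (2 * \<i>)) = integral torus (\<lambda>\<xi>. h x \<xi> - cnj (h (- x) \<xi>)) * inverse (2 * \<i>)"
    by (rule integral_mult_left)
  also have "integral torus (\<lambda>\<xi>. h x \<xi> - cnj (h (- x) \<xi>)) = integral torus (h x) - integral torus (\<lambda>\<xi>. cnj (h (- x) \<xi>))"
    by (rule integral_diff) (use hi in \<open>auto simp: integrable_on_cnj_iff\<close>)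
  also have "integral torus (\<lambda>\<xi>. cnj (h (- x) \<xi>)) = cnj (half_wave (- x) t)"
    unfolding half_wave_def h_def[symmetric] by (rule Henstock_Kurzweil_Integration.integral_cnj[symmetric])
  also have "integral torus (h x) = half_wave x t"
    unfolding half_wave_def h_def[symmetric] ..
  finally show ?thesis by (simp only: divide_inverse[of _ "2 * \<i>"])
qed

text \<open>For small times, where the decay estimate blows up.\<close>

lemma norm_fundamental_solution_le:
  fixes x :: "int ^ 'n::finite"
  shows "norm (fundamental_solution x t) \<le> \<bar>t\<bar> * measure lborel (torus :: (real ^ 'n) set)"
proof -
  let ?g = "\<lambda>\<xi> :: real ^ 'n. cis (lattice_phase x \<xi>) * complex_of_real (sin (t * dispersion \<xi>) / dispersion \<xi>)"
  have "norm (integral torus ?g) \<le> \<bar>t\<bar> * measure lborel (torus :: (real ^ 'n) set)"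
    unfolding torus_eq_cbox
  proof (rule has_integral_bound)
    show "(?g has_integral integral (cbox (\<chi> j. - pi) (\<chi> j. pi)) ?g) (cbox (\<chi> j. - pi) (\<chi> j. pi))"
      using fundamental_solution_eq(1)[of x t] unfolding torus_eq_cbox by (rule integrable_integral)
    show "norm (?g \<xi>) \<le> \<bar>t\<bar>" for \<xi>
      using sin_quotient_bounds[of t "dispersion \<xi>"] by (simp add: norm_mult norm_divide)
  qed simp
  moreover have "norm (1 / (2 * complex_of_real pi) ^ CARD('n)) \<le> 1"
  proof -
    have "1 \<le> (2 * pi) ^ CARD('n)" using pi_gt3 by (intro one_le_power) auto
    then show ?thesis by (simp add: norm_divide norm_power norm_mult)
  qed
  ultimately have "norm (fundamental_solution x t) \<le> 1 * (\<bar>t\<bar> * measure lborel (torus :: (real ^ 'n) set))"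
    unfolding fundamental_solution_eq(2) norm_mult by (intro mult_mono) auto
  then show ?thesis by simp
qed

theorem theorem1p1:
  "\<exists>C>0. \<forall>(x :: int ^ 5) (t :: real).
     norm (fundamental_solution x t) \<le> C * (1 + \<bar>t\<bar>) powr (- (11 / 6))"
proof -
  obtain K where K: "K > 0" "\<And>(x :: int ^ 5) t. t > 0 \<Longrightarrow> norm (half_wave x t) \<le> K * t powr (- (11/6))"
    using half_wave_decay by blast
  define M where "M = measure lborel (torus :: (real ^ 5) set)"
  have M: "M \<ge> 0" by (simp add: M_def)
  \<comment> \<open>The 4 absorbs the doubling of the argument, as
    \<open>2 powr (11/6) \<le> 4\<close>. It is applied at \<open>s = t\<close> for
    \<open>t \<ge> 1\<close> and at \<open>s = 1\<close> for \<open>t < 1\<close>, so that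
    \<open>1 + t \<le> 2 * s\<close> in both cases.\<close>
  have half: "s powr (- (11/6)) \<le> 4 * (2 * s) powr (- (11/6))" if "s > 0" for s :: real
  proof -
    have "(1/4 :: real) = 2 powr (- 2)" by (simp add: powr_minus)
    also have "\<dots> \<le> 2 powr (- (11/6))" by (intro powr_mono) auto
    finally have "1 * s powr (- (11/6)) \<le> (4 * 2 powr (- (11/6))) * s powr (- (11/6))"
      by (intro mult_right_mono) auto
    then show ?thesis using that by (simp add: powr_mult)
  qed
  have mono: "(2 * s) powr (- (11/6)) \<le> (1 + \<bar>t\<bar>) powr (- (11/6))" if "1 + \<bar>t\<bar> \<le> 2 * s" for s t :: real
    using that by (intro powr_mono2') auto
  have pos: "norm (fundamental_solution x t) \<le> 4 * (K + M) * (1 + \<bar>t\<bar>) powr (- (11/6))" if t: "t \<ge> 0" for x :: "int ^ 5" and t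
  proof (cases "t \<ge> 1")
    case True
    have c: "norm (1 / (2 * complex_of_real pi) ^ 5) \<le> 1"
    proof -
      have "1 \<le> (2 * pi) ^ 5" using pi_gt3 by (intro one_le_power) auto
      then show ?thesis by (simp add: norm_divide norm_power norm_mult)
    qed
    have "norm (half_wave x t - cnj (half_wave (- x) t)) \<le> norm (half_wave x t) + norm (half_wave (- x) t)"
      using norm_triangle_ineq4[of "half_wave x t" "cnj (half_wave (- x) t)"] by simp
    also have "\<dots> \<le> 2 * (K * t powr (- (11/6)))"
      using K(2)[of t x] K(2)[of t "- x"] True by simp
    finally have h: "norm ((half_wave x t - cnj (half_wave (- x) t)) / (2 * \<i>)) \<le> K * t powr (- (11/6))"
      by (simp add: norm_divide norm_mult)
    have "norm (fundamental_solution x t) = norm (1 / (2 * complex_of_real pi) ^ 5) * norm ((half_wave x t - cnj (half_wave (- x) t)) / (2 * \<i>))"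
      using True by (simp only: fundamental_solution_eq_half_wave norm_mult)
    also have "\<dots> \<le> 1 * (K * t powr (- (11/6)))"
      by (rule mult_mono[OF c h]) auto
    also have "\<dots> \<le> (K + M) * t powr (- (11/6))"
      using M by (simp add: mult_right_mono)
    also have "\<dots> \<le> (K + M) * (4 * (1 + \<bar>t\<bar>) powr (- (11/6)))"
      using half[of t] mono[of t t] True K M by (intro mult_left_mono) auto
    finally show ?thesis by (simp only: mult_ac)
  next
    case False
    have "norm (fundamental_solution x t) \<le> \<bar>t\<bar> * M"
      unfolding M_def by (rule norm_fundamental_solution_le)
    also have "\<dots> \<le> 1 * (K + M)"
      using False t K M by (intro mult_mono) auto
    also have "\<dots> \<le> (K + M) * (4 * (1 + \<bar>t\<bar>) powr (- (11/6)))"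
    proof -
      have "1 \<le> 4 * (1 + \<bar>t\<bar>) powr (- (11/6))"
        using half[of 1] mono[of t 1] False t by simp
      then have "(K + M) * 1 \<le> (K + M) * (4 * (1 + \<bar>t\<bar>) powr (- (11/6)))"
        using K M by (intro mult_left_mono) auto
      then show ?thesis by simp
    qed
    finally show ?thesis by (simp only: mult_ac)
  qed
  have "norm (fundamental_solution x t) \<le> 4 * (K + M) * (1 + \<bar>t\<bar>) powr (- (11/6))" for x :: "int ^ 5" and t
  proof (cases "t \<ge> 0")
    case True
    then show ?thesis by (rule pos)
  next
    case False
    then show ?thesis using pos[of "- t" x] by (simp add: fundamental_solution_uminus)
  qed
  then show ?thesis using K M by (intro exI[of _ "4 * (K + M)"]) auto
qed

end
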